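(* Let $\Gamma$ be a connected compact metric graph and let $\Omega\subset\Gamma$ be measurable with $0<\ell(\Omega)<\ell(\Gamma)$. Then $$\begin{aligned} h_1^\Gamma(\Omega) &= \sup\{h\in\mathbb{R}^+ : \exists z\in X_K(\Gamma),\ \|z\|_\infty\le 1,\ z'\ge h \text{ in } \Omega\}\\ &= \sup\left\{\frac{1}{\|z\|_\infty} : z\in X_K(\Gamma),\ z'=\chi_\Omega\right\}\\ &= \sup\left\{\frac{1}{\|z\|_\infty} : z\in X_K(\Gamma),\ z'=1 \text{ in } \Omega\right\}.\end{aligned}$$
   Context: $\Gamma$ is a connected compact metric graph: it has finitely many vertices $V(\Gamma)$ and edges $E(\Gamma)$, no loops and no multiple edges; each edge $e$ is identified with an interval $[0,\ell_e]$, $0<\ell_e<\infty$, its initial vertex $i_e$ corresponding to $0$ and its terminal vertex $f_e$ to $\ell_e$. $E_v(\Gamma)$ is the set of edges incident to the vertex $v$. A function $u$ on $\Gamma$ is a collection of functions $[u]_e$ on $(0,\ell_e)$, $e\in E(\Gamma)$; $\int_\Gamma u\,dx=\sum_e\int_0^{\ell_e}[u]_e\,dx$. $L^p(\Gamma)$, $W^{1,p}(\Gamma)$, $BV(\Gamma)$ consist of the $u$ with $[u]_e$ in $L^p(0,\ell_e)$, $W^{1,p}(0,\ell_e)$, $BV(0,\ell_e)$ for every $e$ (no continuity at vertices is required); $u'$ is the edgewise weak derivative, and (in)equalities for $z'$ are meant almost everywhere. $\|\cdot\|_\infty$ is the $L^\infty(\Gamma)$ norm. For $A\subset\Gamma$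 measurable, $\ell(A)=\int_\Gamma \chi_A\,dx$. For $z\in W^{1,2}(\Gamma)$ and $e\in E_v(\Gamma)$ put $[z]_e(v)=[z]_e(\ell_e)$ if $v=f_e$ and $[z]_e(v)=-[z]_e(0)$ if $v=i_e$. Let $X_K(\Gamma)=\{z\in W^{1,2}(\Gamma): \sum_{e\in E_v(\Gamma)}[z]_e(v)=0\ \forall v\in V(\Gamma)\}$. The total variation is $TV_\Gamma(u)=\sup\{|\int_\Gamma u z'\,dx| : z\in X_K(\Gamma),\ \|z\|_{L^\infty(\Gamma)}\le 1\}$ (value in $[0,+\infty]$ for $u\in L^1(\Gamma)$), and $\mathrm{Per}_\Gamma(E)=TV_\Gamma(\chi_E)$. The $\Gamma$-Cheeger constant of $\Omega$ is $h_1^\Gamma(\Omega)=\inf\{\mathrm{Per}_\Gamma(E)/\ell(E) : E\subset\Omega \text{ measurable},\ \ell(E)>0\}$.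
   Formalization: In the second supremum the condition z' = χ_Ω is imposed only almost everywhere in Ω (so it coincides with the third); on all of Γ no z in X_K satisfies it, since the Kirchhoff conditions give ∫_Γ z' dx = 0 while ℓ(Ω) > 0. *)

theory Defs
  imports
    "HOL-Analysis.Analysis"
    "HOL-Probability.Essential_Supremum"
    "Graph_Theory.Digraph"
    "Graph_Theory.Digraph_Component"
begin

text \<open>
  A metric graph is a digraph \<open>G\<close> (the arc \<open>e\<close> runs from \<open>i_e = tail G e\<close> to \<open>f_e = head G e\<close>)
  with edge lengths \<open>len\<close>. \<open>digraph\<close> gives finiteness and excludes loops and parallel
  arcs of the same direction; \<open>no_multi_edges\<close> also excludes a pair of opposite arcs.
  \<open>Digraph_Component.connected\<close> ignores orientations.
\<close>

locale compact_metric_graph = digraph G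
  for G :: "('v, 'e) pre_digraph" +
  fixes len :: "'e \<Rightarrow> real"
  assumes connected_graph: "Digraph_Component.connected G"
    and no_multi_edges:
      "\<lbrakk>e \<in> arcs G; e' \<in> arcs G; {tail G e, head G e} = {tail G e', head G e'}\<rbrakk> \<Longrightarrow> e = e'"
    and len_pos: "e \<in> arcs G \<Longrightarrow> 0 < len e"

text \<open>
  A function on the graph is a family \<open>u :: 'e \<Rightarrow> real \<Rightarrow> real\<close>, of which only the values \<open>u e x\<close>
  with \<open>e \<in> arcs G\<close>, \<open>0 < x < len e\<close> matter. A subset of the graph is a set of pairs \<open>(e, x)\<close>;
  the vertices form a null set and are left out.
\<close>

abbreviation edge_measure :: "real \<Rightarrow> real measure" where
  "edge_measure l \<equiv> lebesgue_on {0<..<l}"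

definition graph_points :: "('v, 'e) pre_digraph \<Rightarrow> ('e \<Rightarrow> real) \<Rightarrow> ('e \<times> real) set" where
  "graph_points G len = (SIGMA e:arcs G. {0<..<len e})"

definition graph_measurable ::
    "('v, 'e) pre_digraph \<Rightarrow> ('e \<Rightarrow> real) \<Rightarrow> ('e \<times> real) set \<Rightarrow> bool" where
  "graph_measurable G len A \<longleftrightarrow>
     A \<subseteq> graph_points G len \<and> (\<forall>e\<in>arcs G. {x. (e, x) \<in> A} \<in> sets lebesgue)"

definition graph_integral ::
    "('v, 'e) pre_digraph \<Rightarrow> ('e \<Rightarrow> real) \<Rightarrow> ('e \<Rightarrow> real \<Rightarrow> real) \<Rightarrow> real" where
  "graph_integral G len u = (\<Sum>e\<in>arcs G. LINT x|edge_measure (len e). u e x)"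

definition chi :: "('e \<times> real) set \<Rightarrow> 'e \<Rightarrow> real \<Rightarrow> real" where
  "chi A e x = indicator A (e, x)"

definition graph_length ::
    "('v, 'e) pre_digraph \<Rightarrow> ('e \<Rightarrow> real) \<Rightarrow> ('e \<times> real) set \<Rightarrow> real" where
  "graph_length G len A = graph_integral G len (chi A)"

text \<open>
  Conditions on \<open>z'\<close> are imposed almost everywhere in a set \<open>A\<close>. This includes the condition
  \<open>z' = chi \<Omega>\<close> for \<open>z\<close> in \<open>X_K\<close>, which is read in \<open>A = \<Omega>\<close>: on the whole graph it has no solution if
  \<open>\<Omega>\<close> has positive length, since summing the Kirchhoff conditions over the vertices shows that
  \<open>z'\<close> has integral \<open>0\<close> over the graph.
\<close>

definition ae_in ::
    "('v, 'e) pre_digraph \<Rightarrow> ('e \<Rightarrow> real) \<Rightarrow> ('e \<times> real) set \<Rightarrow> ('e \<Rightarrow> real \<Rightarrow> bool) \<Rightarrow> bool" where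
  "ae_in G len A P \<longleftrightarrow>
     (\<forall>e\<in>arcs G. AE x in edge_measure (len e). (e, x) \<in> A \<longrightarrow> P e x)"

definition Linf_norm ::
    "('v, 'e) pre_digraph \<Rightarrow> ('e \<Rightarrow> real) \<Rightarrow> ('e \<Rightarrow> real \<Rightarrow> real) \<Rightarrow> ennreal" where
  "Linf_norm G len z = (SUP e\<in>arcs G. esssup (edge_measure (len e)) (\<lambda>x. ennreal \<bar>z e x\<bar>))"

definition L2_edge :: "real \<Rightarrow> (real \<Rightarrow> real) \<Rightarrow> bool" where
  "L2_edge l f \<longleftrightarrow> f \<in> borel_measurable (edge_measure l) \<and> integrable (edge_measure l) (\<lambda>x. (f x)\<^sup>2)"

text \<open>\<open>\<phi>\<close> is a C1 function with compact support in \<open>(0, l)\<close> and \<open>\<psi>\<close> is its derivative.\<close>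

definition test_function :: "real \<Rightarrow> (real \<Rightarrow> real) \<Rightarrow> (real \<Rightarrow> real) \<Rightarrow> bool" where
  "test_function l \<phi> \<psi> \<longleftrightarrow>
     (\<forall>x. (\<phi> has_real_derivative \<psi> x) (at x)) \<and> continuous_on UNIV \<psi> \<and>
     compact (closure {x. \<phi> x \<noteq> 0}) \<and> closure {x. \<phi> x \<noteq> 0} \<subseteq> {0<..<l}"

definition is_weak_deriv :: "real \<Rightarrow> (real \<Rightarrow> real) \<Rightarrow> (real \<Rightarrow> real) \<Rightarrow> bool" where
  "is_weak_deriv l f g \<longleftrightarrow>
     (\<forall>\<phi> \<psi>. test_function l \<phi> \<psi> \<longrightarrow>
       (LINT x|edge_measure l. f x * \<psi> x) = - (LINT x|edge_measure l. g x * \<phi> x))"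

definition W12_edge :: "real \<Rightarrow> (real \<Rightarrow> real) \<Rightarrow> bool" where
  "W12_edge l f \<longleftrightarrow> L2_edge l f \<and> (\<exists>g. L2_edge l g \<and> is_weak_deriv l f g)"

text \<open>The weak derivative is unique up to null sets, and \<open>weak_deriv\<close> picks a representative.\<close>

definition weak_deriv :: "real \<Rightarrow> (real \<Rightarrow> real) \<Rightarrow> real \<Rightarrow> real" where
  "weak_deriv l f = (SOME g. L2_edge l g \<and> is_weak_deriv l f g)"

definition graph_deriv :: "('e \<Rightarrow> real) \<Rightarrow> ('e \<Rightarrow> real \<Rightarrow> real) \<Rightarrow> 'e \<Rightarrow> real \<Rightarrow> real" where
  "graph_deriv len z e = weak_deriv (len e) (z e)"

text \<open>
  The value at \<open>t \<in> [0, l]\<close> of a Sobolev function is that of its continuous representative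
  on \<open>[0, l]\<close>.
\<close>

definition trace_value :: "real \<Rightarrow> (real \<Rightarrow> real) \<Rightarrow> real \<Rightarrow> real" where
  "trace_value l f t =
     (THE c. \<exists>w. continuous_on {0..l} w \<and> (AE x in edge_measure l. w x = f x) \<and> w t = c)"

definition incident_edges :: "('v, 'e) pre_digraph \<Rightarrow> 'v \<Rightarrow> 'e set" where
  "incident_edges G v = {e \<in> arcs G. tail G e = v \<or> head G e = v}"

definition vertex_value ::
    "('v, 'e) pre_digraph \<Rightarrow> ('e \<Rightarrow> real) \<Rightarrow> ('e \<Rightarrow> real \<Rightarrow> real) \<Rightarrow> 'e \<Rightarrow> 'v \<Rightarrow> real" where
  "vertex_value G len z e v =
     (if v = head G e then trace_value (len e) (z e) (len e) else - trace_value (len e) (z e) 0)"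

definition X_K :: "('v, 'e) pre_digraph \<Rightarrow> ('e \<Rightarrow> real) \<Rightarrow> ('e \<Rightarrow> real \<Rightarrow> real) set" where
  "X_K G len =
     {z. (\<forall>e\<in>arcs G. W12_edge (len e) (z e)) \<and>
         (\<forall>v\<in>verts G. (\<Sum>e\<in>incident_edges G v. vertex_value G len z e v) = 0)}"

definition TV :: "('v, 'e) pre_digraph \<Rightarrow> ('e \<Rightarrow> real) \<Rightarrow> ('e \<Rightarrow> real \<Rightarrow> real) \<Rightarrow> ennreal" where
  "TV G len u =
     (SUP z\<in>{z \<in> X_K G len. Linf_norm G len z \<le> 1}.
        ennreal \<bar>graph_integral G len (\<lambda>e x. u e x * graph_deriv len z e x)\<bar>)"

definition perimeter :: "('v, 'e) pre_digraph \<Rightarrow> ('e \<Rightarrow> real) \<Rightarrow> ('e \<times> real) set \<Rightarrow> ennreal" where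
  "perimeter G len E = TV G len (chi E)"

text \<open>
  The Cheeger constant is \<open>\<infinity>\<close> when \<open>\<Omega>\<close> has no subset of positive length and finite perimeter
  (for instance, a nowhere dense closed set of positive length), so it lives in \<open>ennreal\<close>.
\<close>

definition cheeger_constant ::
    "('v, 'e) pre_digraph \<Rightarrow> ('e \<Rightarrow> real) \<Rightarrow> ('e \<times> real) set \<Rightarrow> ennreal" where
  "cheeger_constant G len \<Omega> =
     (INF E\<in>{E. E \<subseteq> \<Omega> \<and> graph_measurable G len E \<and> 0 < graph_length G len E}.
        perimeter G len E / ennreal (graph_length G len E))"

end

theory Submission
  imports Defs
begin

text \<open>
  If \<open>z' \<ge> h\<close> in \<open>\<Omega>\<close> and \<open>\<parallel>z\<parallel> \<le> 1\<close>, testing the perimeter of \<open>E \<subseteq> \<Omega>\<close> with \<open>z\<close> gives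
  \<open>Per E \<ge> h * length E\<close>. So only the construction of \<open>z\<close> with \<open>z' = 1\<close> in \<open>\<Omega>\<close> and \<open>\<parallel>z\<parallel> \<le> 1 / h\<close> for
  \<open>h\<close> below the Cheeger constant remains, and this is a max-flow min-cut argument. Cut the edges into
  small cells. On a cell not contained in \<open>\<Omega>\<close> (up to null sets) \<open>z\<close> can make any increment while
  \<open>z' = 1\<close> in \<open>\<Omega>\<close>, so only the cells contained in \<open>\<Omega>\<close>, together with the Kirchhoff conditions,
  constrain the values of \<open>z\<close> at the division points. These values form a flow with capacities
  \<open>1 / h\<close> and prescribed net outflows. The cut condition of the supply-demand theorem is the
  Cheeger inequality for the unions \<open>E\<close> of cells contained in \<open>\<Omega>\<close>, because \<open>Per E\<close> is at most the size
  of any cut whose cells are those of \<open>E\<close>. The overshoot inside the cells is absorbed by first passing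
  to a slightly larger \<open>h\<close>.
\<close>

section \<open>Sobolev functions on an interval\<close>

lemma finite_edge_measure: "finite_measure (edge_measure l)"
  by (rule finite_measure_lebesgue_on) simp

lemma borel_measurable_edge_indicator [measurable]:
  "A \<in> sets lebesgue \<Longrightarrow> (indicator A :: real \<Rightarrow> real) \<in> borel_measurable (edge_measure l)"
  by (rule measurable_restrict_space1) simp

lemma borel_measurable_edge_continuous:
  fixes f :: "real \<Rightarrow> real"
  shows "continuous_on UNIV f \<Longrightarrow> f \<in> borel_measurable (edge_measure l)"
  by (intro measurable_restrict_space1 measurable_completion) (simp add: borel_measurable_continuous_onI)

lemma continuous_bounded_on_edge:
  fixes f :: "real \<Rightarrow> real"
  assumes "continuous_on UNIV f"
  shows "\<exists>B. \<forall>x\<in>{0..l}. \<bar>f x\<bar> \<le> B"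
proof -
  have "compact (f ` {0..l})"
    by (intro compact_continuous_image continuous_on_subset[OF assms]) auto
  then have "bounded (f ` {0..l})" by (rule compact_imp_bounded)
  then obtain B where "\<forall>y\<in>f ` {0..l}. norm y \<le> B" using bounded_iff by blast
  then show ?thesis by auto
qed

lemma integrable_edge_continuous:
  fixes f :: "real \<Rightarrow> real"
  assumes "continuous_on UNIV f"
  shows "integrable (edge_measure l) f"
proof -
  interpret M: finite_measure "edge_measure l" by (rule finite_edge_measure)
  obtain B where "\<And>x. x \<in> {0..l} \<Longrightarrow> \<bar>f x\<bar> \<le> B"
    using continuous_bounded_on_edge[OF assms] by blast
  then show ?thesis
    by (intro M.integrable_const_bound[where B = B] borel_measurable_edge_continuous[OF assms]) (auto intro!: AE_I2)
qed

lemma integrable_edge_indicator_mult: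
  fixes g :: "real \<Rightarrow> real"
  assumes "integrable (edge_measure l) g" "A \<in> sets lebesgue"
  shows "integrable (edge_measure l) (\<lambda>t. indicator A t * g t)"
proof (rule Bochner_Integration.integrable_bound[OF assms(1)])
  show "(\<lambda>t. indicator A t * g t) \<in> borel_measurable (edge_measure l)"
    using assms borel_measurable_edge_indicator by (intro borel_measurable_times) auto
qed (auto simp: indicator_def)

lemma integrable_edge_bounded_mult:
  fixes g :: "real \<Rightarrow> real"
  assumes "integrable (edge_measure l) g" "h \<in> borel_measurable (edge_measure l)"
    and "\<And>t. \<bar>h t\<bar> \<le> B"
  shows "integrable (edge_measure l) (\<lambda>t. h t * g t)"
proof (rule Bochner_Integration.integrable_bound[of _ "\<lambda>t. B * g t"])
  show "(\<lambda>t. h t * g t) \<in> borel_measurable (edge_measure l)"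
    using assms by (intro borel_measurable_times) auto
  show "AE t in edge_measure l. norm (h t * g t) \<le> norm (B * g t)"
    using order_trans[OF assms(3) abs_ge_self] by (intro AE_I2) (auto simp: abs_mult intro!: mult_right_mono)
qed (use assms in auto)

section \<open>Primitives of integrable functions and their weak derivatives\<close>

text \<open>Placing the indicator under an integral over the whole edge makes the primitive total in
  \<open>x\<close>, constant to the left of \<open>0\<close> and to the right of \<open>l\<close>,
  so that its continuity can be stated on \<open>UNIV\<close>.\<close>

definition primitive :: "real \<Rightarrow> (real \<Rightarrow> real) \<Rightarrow> real \<Rightarrow> real" where
  "primitive l g x = (LINT t|edge_measure l. indicator {..<x} t * g t)"

lemma primitive_diff:
  assumes "integrable (edge_measure l) g" "x \<le> y"
  shows "primitive l g y - primitive l g x = (LINT t|edge_measure l. indicator {x..<y} t * g t)"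
proof -
  have "primitive l g y - primitive l g x
      = (LINT t|edge_measure l. indicator {..<y} t * g t - indicator {..<x} t * g t)"
    unfolding primitive_def
    by (rule Bochner_Integration.integral_diff[symmetric]) (auto intro: integrable_edge_indicator_mult assms)
  also have "\<dots> = (LINT t|edge_measure l. indicator {x..<y} t * g t)"
    using assms(2) by (intro Bochner_Integration.integral_cong) (auto simp: indicator_def)
  finally show ?thesis .
qed

lemma primitive_0: "primitive l g 0 = 0"
proof -
  have "primitive l g 0 = (LINT t|edge_measure l. 0)"
    unfolding primitive_def by (rule Bochner_Integration.integral_cong) (auto simp: indicator_def)
  then show ?thesis by simp
qed

lemma AE_edge_neq: "AE t in edge_measure l. t \<noteq> (x::real)"
proof -
  have "AE t in lebesgue. t \<noteq> x"
    by (rule AE_I'[of "{x}"]) auto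
  then show ?thesis by (subst AE_restrict_space_iff) auto
qed

text \<open>Dominated convergence: along \<open>u n\<close> the indicators converge at every
  \<open>t\<close> other than \<open>x\<close>, and a single point is null.\<close>

lemma continuous_primitive:
  assumes "integrable (edge_measure l) g"
  shows "continuous_on UNIV (primitive l g)"
proof (subst continuous_on_sequentially, clarify)
  fix u :: "nat \<Rightarrow> real" and x
  assume u: "u \<longlonglongrightarrow> x"
  have "(\<lambda>n. LINT t|edge_measure l. indicator {..<u n} t * g t)
      \<longlonglongrightarrow> (LINT t|edge_measure l. indicator {..<x} t * g t)"
  proof (rule integral_dominated_convergence[where w = "\<lambda>t. \<bar>g t\<bar>"])
    show "AE t in edge_measure l. (\<lambda>n. indicator {..<u n} t * g t) \<longlonglongrightarrow> indicator {..<x} t * g t"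
      using AE_edge_neq[where l = l and x = x]
    proof eventually_elim
      case (elim t)
      have "\<forall>\<^sub>F n in sequentially. indicator {..<u n} t * g t = indicator {..<x} t * g t"
      proof (cases "t < x")
        case True
        from order_tendstoD(1)[OF u this] show ?thesis
          by eventually_elim (auto simp: indicator_def True)
      next
        case False
        with elim have "x < t" by auto
        from order_tendstoD(2)[OF u this] show ?thesis
          by eventually_elim (use False in \<open>auto simp: indicator_def\<close>)
      qed
      then show ?case by (rule tendsto_eventually)
    qed
  qed (use assms in \<open>auto intro!: borel_measurable_integrable integrable_edge_indicator_mult split: split_indicator\<close>)
  then show "(primitive l g \<circ> u) \<longlonglongrightarrow> primitive l g x"
    unfolding primitive_def o_def .
qed

text \<open>The fundamental theorem of calculus, with \<open>\<phi> l = 0\<close> because the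
  support lies in the open interval. This is the inner integral left over by Fubini in
  \<open>is_weak_deriv_primitive\<close>.\<close>

lemma test_function_integral:
  assumes t: "test_function l \<phi> \<psi>" and x: "0 \<le> x" "x \<le> l"
  shows "(LINT t|edge_measure l. indicator {x<..} t * \<psi> t) = - \<phi> x"
proof -
  have der: "(\<phi> has_real_derivative \<psi> y) (at y)" for y using t by (auto simp: test_function_def)
  have cont: "continuous_on S \<psi>" for S using t by (auto simp: test_function_def intro: continuous_on_subset)
  have "{y. \<phi> y \<noteq> 0} \<subseteq> {0<..<l}"
    using t closure_subset[of "{y. \<phi> y \<noteq> 0}"] by (auto simp: test_function_def)
  then have l: "\<phi> l = 0" by auto
  have "(\<psi> has_integral (\<phi> l - \<phi> x)) {x..l}"
    using x der by (intro fundamental_theorem_of_calculus)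
      (auto simp: has_real_derivative_iff_has_vector_derivative[symmetric] intro: has_field_derivative_at_within)
  then have 1: "integral {x..l} \<psi> = - \<phi> x" using l by (simp add: integral_unique)
  have "integrable (lebesgue_on {x..l}) \<psi>"
    by (rule continuous_imp_integrable_real[OF cont])
  then have "integral\<^sup>L (lebesgue_on {x..l}) \<psi> = integral {x..l} \<psi>"
    by (rule lebesgue_integral_eq_integral) auto
  moreover have "integral\<^sup>L (lebesgue_on {x..l}) \<psi> = (LINT t|lebesgue. indicator {x..l} t * \<psi> t)"
    by (subst integral_restrict_space) auto
  moreover have "(LINT t|edge_measure l. indicator {x<..} t * \<psi> t)
      = (LINT t|lebesgue. indicator {0<..<l} t * (indicator {x<..} t * \<psi> t))"
    by (subst integral_restrict_space) auto
  moreover have "(LINT t|lebesgue. indicator {0<..<l} t * (indicator {x<..} t * \<psi> t))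
      = (LINT t|lebesgue. indicator {x..l} t * \<psi> t)"
  proof (rule integral_cong_AE)
    have "AE t in lebesgue. t \<noteq> x" "AE t in lebesgue. t \<noteq> l"
      by (auto intro: AE_I'[of "{x}"] AE_I'[of "{l}"])
    then show "AE t in lebesgue. indicator {0<..<l} t * (indicator {x<..} t * \<psi> t) = indicator {x..l} t * \<psi> t"
      by eventually_elim (use x in \<open>auto simp: indicator_def\<close>)
  qed (use cont[of UNIV] in \<open>auto intro!: borel_measurable_times measurable_completion borel_measurable_continuous_onI\<close>)
  ultimately show ?thesis using 1 by simp
qed

text \<open>Integration by parts by Fubini on the triangle \<open>t < x\<close>: exchanging the
  order replaces the primitive tested with \<open>\<psi>\<close> by \<open>g t\<close> times the
  integral of \<open>\<psi>\<close> over \<open>(t, l)\<close>, which is \<open>- \<phi> t\<close>.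
  The constant \<open>c\<close> drops out since \<open>\<psi>\<close> has mean zero.\<close>

lemma is_weak_deriv_primitive:
  assumes g: "integrable (edge_measure l) g"
  shows "is_weak_deriv l (\<lambda>x. c + primitive l g x) g"
  unfolding is_weak_deriv_def
proof (intro allI impI)
  fix \<phi> \<psi> assume t: "test_function l \<phi> \<psi>"
  let ?M = "edge_measure l"
  interpret M: finite_measure ?M by (rule finite_edge_measure)
  interpret P: pair_sigma_finite ?M ?M by unfold_locales
  have cont: "continuous_on S \<psi>" for S using t by (auto simp: test_function_def intro: continuous_on_subset)
  have psi_m [measurable]: "\<psi> \<in> borel_measurable ?M" by (rule borel_measurable_edge_continuous[OF cont])
  have g_m [measurable]: "g \<in> borel_measurable ?M" using g by auto
  have psi_i: "integrable ?M \<psi>" by (rule integrable_edge_continuous[OF cont])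
  define F where "F = (\<lambda>(x, t). of_bool (t < x) * (\<psi> x * g t))"
  have id1 [measurable]: "(\<lambda>x. x) \<in> borel_measurable ?M"
    by (rule borel_measurable_edge_continuous) (auto intro: continuous_intros)
  have Fm [measurable]: "F \<in> borel_measurable (?M \<Otimes>\<^sub>M ?M)"
    unfolding F_def of_bool_def by measurable
  \<comment> \<open>This product dominates \<open>F\<close>, which gives the integrability that
    Fubini asks for.\<close>
  have GI: "integrable (?M \<Otimes>\<^sub>M ?M) (\<lambda>(x, t). \<psi> x * g t)"
  proof (rule P.Fubini_integrable)
    show "integrable ?M (\<lambda>x. LINT t|?M. norm (case (x, t) of (x, t) \<Rightarrow> \<psi> x * g t))"
      using psi_i by (simp add: abs_mult)
  qed (use g in auto)
  have FI: "integrable (?M \<Otimes>\<^sub>M ?M) F"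
    by (rule Bochner_Integration.integrable_bound[OF GI Fm]) (auto simp: F_def)
  have "(LINT x|?M. (c + primitive l g x) * \<psi> x)
      = (LINT x|?M. c * \<psi> x + (LINT t|?M. F (x, t)))"
  proof (rule Bochner_Integration.integral_cong)
    fix x
    have "(LINT t|?M. F (x, t)) = (LINT t|?M. \<psi> x * (indicator {..<x} t * g t))"
      by (rule Bochner_Integration.integral_cong) (auto simp: F_def indicator_def)
    then show "(c + primitive l g x) * \<psi> x = c * \<psi> x + (LINT t|?M. F (x, t))"
      by (simp add: primitive_def algebra_simps)
  qed simp
  also have "\<dots> = c * (LINT x|?M. \<psi> x) + (LINT x|?M. LINT t|?M. F (x, t))"
    using P.integrable_fst'[OF FI] psi_i by (subst Bochner_Integration.integral_add) auto
  also have "(LINT x|?M. LINT t|?M. F (x, t)) = (LINT t|?M. LINT x|?M. F (x, t))"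
    using P.Fubini_integral[of "\<lambda>x t. F (x, t)"] FI by simp
  also have "\<dots> = (LINT t|?M. - (g t * \<phi> t))"
  proof (rule Bochner_Integration.integral_cong)
    fix t assume "t \<in> space ?M"
    then have tl: "0 \<le> t" "t \<le> l" by auto
    have "(LINT x|?M. F (x, t)) = (LINT x|?M. g t * (indicator {t<..} x * \<psi> x))"
      by (rule Bochner_Integration.integral_cong) (auto simp: F_def indicator_def)
    then show "(LINT x|?M. F (x, t)) = - (g t * \<phi> t)"
      using test_function_integral[OF t tl] by simp
  qed simp
  also have "(LINT x|?M. \<psi> x) = 0"
  proof (cases "0 \<le> l")
    case True
    have "(LINT x|?M. \<psi> x) = (LINT x|?M. indicator {0<..} x * \<psi> x)"
      by (rule Bochner_Integration.integral_cong) (auto simp: indicator_def)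
    moreover have "\<phi> 0 = 0"
      using t closure_subset[of "{y. \<phi> y \<noteq> 0}"] by (auto simp: test_function_def)
    ultimately show ?thesis using test_function_integral[OF t order.refl True] by simp
  next
    case False
    then show ?thesis by (simp add: integral_lebesgue_on_empty)
  qed
  finally show "(LINT x|?M. (c + primitive l g x) * \<psi> x) = - (LINT x|?M. g x * \<phi> x)" by simp
qed

section \<open>Du Bois-Reymond lemma and uniqueness of the weak derivative\<close>

text \<open>An antiderivative of \<open>\<psi>\<close> is constant on each side of
  \<open>(a, b)\<close>. Mean zero makes the two constants equal, and subtracting them leaves a
  function supported in \<open>[a, b]\<close>.\<close>

lemma mean_zero_test_function:
  assumes cont: "continuous_on UNIV \<psi>" and zero: "\<And>x. x \<notin> {a<..<b} \<Longrightarrow> \<psi> x = 0"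
    and ab: "0 < a" "a < b" "b < l" and int: "(LINT x|edge_measure l. \<psi> x) = 0"
  shows "\<exists>\<phi>. test_function l \<phi> \<psi>"
proof -
  have "\<exists>F. \<forall>x. (F has_vector_derivative \<psi> x) (at x)"
    using einterval_antiderivative[of "-\<infinity>" "\<infinity>" \<psi>] cont by (auto simp: continuous_on_eq_continuous_at)
  then obtain F where F: "\<And>x. (F has_real_derivative \<psi> x) (at x)"
    by (auto simp: has_real_derivative_iff_has_vector_derivative)
  have left: "F x = F a" if "x \<le> a" for x
  proof -
    have "\<exists>c. \<forall>x\<in>{..a}. F x = c"
    proof (rule has_field_derivative_zero_constant)
      fix x assume "x \<in> {..a}"
      then have "\<psi> x = 0" using zero by auto
      then show "(F has_field_derivative 0) (at x within {..a})"
        using F[of x] by (auto intro: has_field_derivative_at_within)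
    qed auto
    then show ?thesis using that by force
  qed
  have right: "F x = F b" if "b \<le> x" for x
  proof -
    have "\<exists>c. \<forall>x\<in>{b..}. F x = c"
    proof (rule has_field_derivative_zero_constant)
      fix x assume "x \<in> {b..}"
      then have "\<psi> x = 0" using zero by auto
      then show "(F has_field_derivative 0) (at x within {b..})"
        using F[of x] by (auto intro: has_field_derivative_at_within)
    qed auto
    then show ?thesis using that by force
  qed
  have "(\<psi> has_integral (F l - F 0)) {0..l}"
    using ab F by (intro fundamental_theorem_of_calculus)
      (auto simp: has_real_derivative_iff_has_vector_derivative[symmetric] intro: has_field_derivative_at_within)
  then have 1: "integral {0<..<l} \<psi> = F b - F a"
    using left[of 0] right[of l] ab integral_open_interval_real[of 0 l \<psi>] by (simp add: integral_unique)
  have "integrable (edge_measure l) \<psi>" by (rule integrable_edge_continuous[OF cont])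
  then have "(LINT x|edge_measure l. \<psi> x) = integral {0<..<l} \<psi>"
    by (rule lebesgue_integral_eq_integral) auto
  with 1 int have ba: "F b = F a" by simp
  define \<phi> where "\<phi> = (\<lambda>x. F x - F a)"
  have supp: "{x. \<phi> x \<noteq> 0} \<subseteq> {a..b}"
  proof (rule subsetI, rule ccontr)
    fix x assume x: "x \<in> {x. \<phi> x \<noteq> 0}" "x \<notin> {a..b}"
    then consider "x \<le> a" | "b \<le> x" by fastforce
    then have "F x = F a" using left[of x] right[of x] ba by cases (simp_all only:)
    with x show False by (simp add: \<phi>_def)
  qed
  then have cl: "closure {x. \<phi> x \<noteq> 0} \<subseteq> {a..b}" by (rule closure_minimal) auto
  have "test_function l \<phi> \<psi>"
    unfolding test_function_def
  proof (intro conjI allI)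
    show "(\<phi> has_real_derivative \<psi> x) (at x)" for x
      unfolding \<phi>_def using DERIV_diff[OF F DERIV_const] by simp
    show "compact (closure {x. \<phi> x \<noteq> 0})"
      using bounded_subset[OF bounded_closed_interval supp] by (simp add: compact_closure)
    show "closure {x. \<phi> x \<noteq> 0} \<subseteq> {0<..<l}"
      by (rule subset_trans[OF cl]) (use ab in auto)
  qed (rule cont)
  then show ?thesis by blast
qed

text \<open>Plateau functions with flanks of slope \<open>n\<close> that increase to the indicator
  of \<open>(a, b)\<close>. Continuity suffices because test functions are only C1, so their
  derivatives only continuous.\<close>

definition trapezoid :: "real \<Rightarrow> real \<Rightarrow> nat \<Rightarrow> real \<Rightarrow> real" where
  "trapezoid a b n x = min 1 (real n * max 0 (min (x - a) (b - x)))"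

lemma continuous_trapezoid: "continuous_on S (trapezoid a b n)"
  unfolding trapezoid_def by (intro continuous_intros)

lemma trapezoid_outside: "x \<notin> {a<..<b} \<Longrightarrow> trapezoid a b n x = 0"
  by (auto simp: trapezoid_def)

lemma trapezoid_bounds: "0 \<le> trapezoid a b n x" "trapezoid a b n x \<le> 1"
  by (auto simp: trapezoid_def)

lemma abs_trapezoid_le: "\<bar>trapezoid a b n x\<bar> \<le> 1"
  using trapezoid_bounds[of a b n x] by simp

lemma trapezoid_LIMSEQ: "(\<lambda>n. trapezoid a b n x) \<longlonglongrightarrow> indicator {a<..<b} x"
proof (cases "x \<in> {a<..<b}")
  case True
  define d where "d = min (x - a) (b - x)"
  have d: "d > 0" using True by (auto simp: d_def)
  have "\<forall>\<^sub>F n in sequentially. trapezoid a b n x = 1"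
    using eventually_ge_at_top[of "nat \<lceil>1 / d\<rceil>"]
  proof eventually_elim
    case (elim n)
    then have "1 / d \<le> real n" by linarith
    then have "1 \<le> real n * d" using d by (simp add: field_simps)
    then show ?case using d by (simp add: trapezoid_def d_def[symmetric] max_def)
  qed
  then show ?thesis using True by (simp add: tendsto_eventually)
qed (simp add: trapezoid_outside)


text \<open>Open intervals form an intersection-stable generator of the Borel sets, so a Dynkin
  argument carries the vanishing of the integral to all Borel sets, and null sets carry it on to
  Lebesgue sets.\<close>

lemma AE_zero_of_interval_integrals_zero:
  fixes v :: "real \<Rightarrow> real"
  assumes v: "integrable (edge_measure l) v"
    and zero: "\<And>a b. \<lbrakk>0 < a; a < b; b < l\<rbrakk> \<Longrightarrow> (LINT t|edge_measure l. indicator {a<..<b} t * v t) = 0"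
  shows "AE t in edge_measure l. v t = 0"
proof -
  let ?M = "edge_measure l"
  interpret M: finite_measure ?M by (rule finite_edge_measure)
  have ind: "integrable ?M (\<lambda>t. indicator A t * v t)" if "A \<in> sets lebesgue" for A
    by (rule integrable_edge_indicator_mult[OF v that])
  \<comment> \<open>The hypothesis covers only intervals compactly inside \<open>(0, l)\<close>.
    Keeping the ends at distance \<open>1 / Suc n\<close> from the boundary and letting
    \<open>n\<close> grow removes this restriction.\<close>
  have closed: "(LINT t|?M. indicator {a<..<b} t * v t) = 0" for a b
  proof -
    define p q where "p = (\<lambda>n::nat. max a (1 / Suc n))" and "q = (\<lambda>n::nat. min b (l - 1 / Suc n))"
    have p: "p \<longlonglongrightarrow> max a 0" unfolding p_def
      using LIMSEQ_inverse_real_of_nat by (intro tendsto_intros) (simp add: inverse_eq_divide)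
    have q: "q \<longlonglongrightarrow> min b (l - 0)" unfolding q_def
      using LIMSEQ_inverse_real_of_nat by (intro tendsto_intros) (simp add: inverse_eq_divide)
    have pq0: "(LINT t|?M. indicator {p n<..<q n} t * v t) = 0" for n
    proof (cases "p n < q n")
      case True
      have "0 < p n" "q n < l" by (auto simp: p_def q_def less_max_iff_disj min_less_iff_disj)
      then show ?thesis using zero True by simp
    qed simp
    have "(\<lambda>n. LINT t|?M. indicator {p n<..<q n} t * v t)
        \<longlonglongrightarrow> (LINT t|?M. indicator {a<..<b} t * v t)"
    proof (rule integral_dominated_convergence[where w = "\<lambda>t. \<bar>v t\<bar>"])
      show "AE t in ?M. (\<lambda>n. indicator {p n<..<q n} t * v t) \<longlonglongrightarrow> indicator {a<..<b} t * v t"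
      proof (rule AE_I2)
        fix t assume "t \<in> space ?M"
        then have t: "0 < t" "t < l" by auto
        have "\<forall>\<^sub>F n in sequentially. indicator {p n<..<q n} t * v t = indicator {a<..<b} t * v t"
        proof (cases "t \<in> {a<..<b}")
          case True
          then have "max a 0 < t" "t < min b (l - 0)" using t by auto
          with order_tendstoD(2)[OF p] order_tendstoD(1)[OF q]
          have "\<forall>\<^sub>F n in sequentially. p n < t \<and> t < q n" by (auto intro: eventually_conj)
          then show ?thesis by eventually_elim (use True in auto)
        next
          case False
          then have "t \<notin> {p n<..<q n}" for n by (auto simp: p_def q_def)
          with False show ?thesis by simp
        qed
        then show "(\<lambda>n. indicator {p n<..<q n} t * v t) \<longlonglongrightarrow> indicator {a<..<b} t * v t"
          by (rule tendsto_eventually)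
      qed
    qed (use v in \<open>auto intro!: borel_measurable_integrable ind split: split_indicator\<close>)
    then show ?thesis by (simp add: pq0 tendsto_const_iff)
  qed
  have all: "(LINT t|?M. v t) = 0"
  proof -
    have "(LINT t|?M. indicator {0<..<l} t * v t) = (LINT t|?M. v t)"
      by (rule Bochner_Integration.integral_cong) auto
    then show ?thesis using closed by simp
  qed
  have borel: "(LINT t|?M. indicator B t * v t) = 0" if "B \<in> sets borel" for B
  proof -
    have gen: "sigma_sets UNIV (range (\<lambda>(a::real, b). {a<..<b})) = sets borel"
      by (simp add: borel_eq_box)
    have "Int_stable (range (\<lambda>(a::real, b). {a<..<b}))"
      by (auto simp: Int_stable_def)
    moreover have "range (\<lambda>(a::real, b). {a<..<b}) \<subseteq> Pow UNIV" by simp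
    moreover have "B \<in> sigma_sets UNIV (range (\<lambda>(a::real, b). {a<..<b}))"
      using that gen by simp
    ultimately show ?thesis
    proof (induction rule: sigma_sets_induct_disjoint)
      case (basic A)
      then show ?case using closed by auto
    next
      case (compl A)
      then have A: "A \<in> sets lebesgue" by (simp add: gen)
      have "(LINT t|?M. indicator (UNIV - A) t * v t) = (LINT t|?M. v t - indicator A t * v t)"
        by (rule Bochner_Integration.integral_cong) (auto simp: indicator_def)
      also have "\<dots> = 0"
        using all compl(2) v ind[OF A] by (subst Bochner_Integration.integral_diff) auto
      finally show ?case .
    next
      case (union A)
      have A: "A i \<in> sets lebesgue" for i
        using range_subsetD[OF union(2), of i] by (simp add: gen)
      define A' where "A' = (\<lambda>i. A i \<inter> {0<..<l})"
      have A': "A' i \<in> sets ?M" for i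
        using A[of i] by (auto simp: A'_def sets_restrict_space)
      have "(LINT t|?M. indicator (\<Union>i. A i) t * v t) = (LINT t:(\<Union>i. A' i)|?M. v t)"
        unfolding set_lebesgue_integral_def
        by (rule Bochner_Integration.integral_cong) (auto simp: A'_def indicator_def)
      also have "\<dots> = (\<Sum>i. LINT t:A' i|?M. v t)"
      proof (rule lebesgue_integral_countable_add[OF A'])
        show "A' i \<inter> A' j = {}" if "i \<noteq> j" for i j
          using union(1) that by (auto simp: A'_def disjoint_family_on_def)
        have "(\<Union>i. A' i) \<in> sets ?M" using A' by auto
        then show "set_integrable ?M (\<Union>i. A' i) v"
          unfolding set_integrable_def using v by (rule integrable_mult_indicator)
      qed
      also have "\<dots> = (\<Sum>i. LINT t|?M. indicator (A i) t * v t)"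
        unfolding set_lebesgue_integral_def
        by (intro suminf_cong Bochner_Integration.integral_cong) (auto simp: A'_def indicator_def)
      finally have "(LINT t|?M. indicator (\<Union>i. A i) t * v t) = \<dots>" .
      then show ?case using union by simp
    qed (auto)
  qed
  have "set_lebesgue_integral ?M A v = 0" if "A \<in> sets ?M" for A
  proof -
    \<comment> \<open>A Lebesgue set differs from a Borel set \<open>S\<close> by a null
      set.\<close>
    from that have AL: "A \<in> sets lebesgue" by (auto simp: sets_restrict_space)
    then obtain S N N' where "A = S \<union> N" "N \<subseteq> N'" "N' \<in> null_sets lborel" "S \<in> sets lborel"
      by (rule sets_completionE)
    then have "AE t in lebesgue. t \<in> A \<longleftrightarrow> t \<in> S"
      by (intro AE_I'[of N']) (auto intro: null_sets_completionI)
    then have AS: "AE t in ?M. t \<in> A \<longleftrightarrow> t \<in> S"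
      by (subst AE_restrict_space_iff) auto
    have "(LINT t|?M. indicator A t * v t) = (LINT t|?M. indicator S t * v t)"
      by (rule integral_cong_AE) (use AS ind AL \<open>S \<in> sets lborel\<close> in \<open>auto simp: indicator_def intro!: borel_measurable_integrable\<close>)
    also have "\<dots> = 0" using borel \<open>S \<in> sets lborel\<close> by simp
    finally show "set_lebesgue_integral ?M A v = 0" by (simp add: set_lebesgue_integral_def)
  qed
  then show ?thesis by (rule M.density_zero[OF v])
qed

text \<open>A violation at \<open>t\<close> persists, by continuity, on an interval inside
  \<open>(0, l)\<close>. This interval has positive length even if \<open>t\<close> is an endpoint,
  which is what makes boundary values well defined.\<close>

lemma edge_AE_le_continuous:
  fixes h :: "real \<Rightarrow> real"
  assumes l: "0 < l" and cont: "continuous_on {0..l} h"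
    and AE: "AE x in edge_measure l. h x \<le> C" and t: "t \<in> {0..l}"
  shows "h t \<le> C"
proof (rule ccontr)
  assume "\<not> h t \<le> C"
  then have "0 < h t - C" by simp
  then obtain d where d: "d > 0" "\<And>x. x \<in> {0..l} \<Longrightarrow> dist x t < d \<Longrightarrow> dist (h x) (h t) < h t - C"
    using cont t unfolding continuous_on_iff by metis
  define J where "J = {max 0 (t - d)<..<min l (t + d)}"
  have J: "h x > C" "0 < x" "x < l" if "x \<in> J" for x
  proof -
    have x: "x \<in> {0..l}" "\<bar>x - t\<bar> < d" using that by (auto simp: J_def)
    then have "\<bar>h x - h t\<bar> < h t - C" using d(2)[of x] by (simp add: dist_real_def)
    then show "h x > C" by linarith
  qed (use that in \<open>auto simp: J_def\<close>)
  have "AE x in lebesgue. x \<in> {0<..<l} \<longrightarrow> h x \<le> C"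
    using AE by (subst (asm) AE_restrict_space_iff) auto
  then have "AE x in lebesgue. x \<notin> J"
    by eventually_elim (use J in force)
  then have "J \<in> null_sets lebesgue"
    by (subst AE_iff_null_sets) (auto simp: J_def)
  moreover have "emeasure lebesgue J > 0"
    using l t d(1) by (auto simp: J_def)
  ultimately show False by (auto dest: null_setsD1)
qed

lemma edge_AE_eq_continuous:
  fixes f g :: "real \<Rightarrow> real"
  assumes "0 < l" "continuous_on {0..l} f" "continuous_on {0..l} g"
    and "AE x in edge_measure l. f x = g x" and "t \<in> {0..l}"
  shows "f t = g t"
proof -
  have "\<bar>f t - g t\<bar> \<le> 0"
    using assms by (intro edge_AE_le_continuous[of l "\<lambda>x. \<bar>f x - g x\<bar>"] continuous_intros) auto
  then show ?thesis by simp
qed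

text \<open>A trapezoid corrected to mean zero is the derivative of a test function, so
  \<open>u\<close> integrates to zero against it. Rearranged, \<open>u - c\<close> is orthogonal to
  every trapezoid, and in the limit to every interval.\<close>

lemma weak_deriv_zero_imp_constant:
  assumes l: "0 < l" and u: "integrable (edge_measure l) u"
    and wd: "is_weak_deriv l u (\<lambda>_. 0)"
  shows "\<exists>c. AE x in edge_measure l. u x = c"
proof -
  let ?M = "edge_measure l"
  interpret M: finite_measure ?M by (rule finite_edge_measure)
  \<comment> \<open>\<open>\<beta>\<close> is a fixed bump with nonzero integral \<open>m\<close>;
    subtracting a multiple of it corrects a trapezoid to mean zero. This forces \<open>c\<close> to
    be the mean of \<open>u\<close> with weight \<open>\<beta>\<close>.\<close>
  define \<beta> where "\<beta> = trapezoid (l/4) (3*l/4) 1"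
  define m where "m = (LINT x|?M. \<beta> x)"
  define c where "c = (LINT x|?M. \<beta> x * u x) / m"
  have Ti: "integrable ?M (trapezoid a b n)" for a b n
    by (rule integrable_edge_continuous[OF continuous_trapezoid])
  have Tui: "integrable ?M (\<lambda>x. trapezoid a b n x * v x)" if "integrable ?M v" for a b n v
    by (intro integrable_edge_bounded_mult[where B = 1] borel_measurable_edge_continuous
        continuous_trapezoid that abs_trapezoid_le)
  have "m \<noteq> 0"
  proof
    assume "m = 0"
    then have "AE x in ?M. \<beta> x = 0"
      using trapezoid_bounds Ti unfolding m_def \<beta>_def
      by (subst (asm) integral_nonneg_eq_0_iff_AE) auto
    then have "AE x in ?M. \<beta> x \<le> 0" by eventually_elim simp
    then have "\<beta> (l/2) \<le> 0"
      using l by (intro edge_AE_le_continuous[of l \<beta>]) (auto simp: \<beta>_def continuous_trapezoid)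
    then show False using l by (auto simp: \<beta>_def trapezoid_def)
  qed
  have T: "(LINT x|?M. trapezoid a b n x * (u x - c)) = 0" if ab: "0 < a" "a < b" "b < l" for a b n
  proof -
    define r where "r = (LINT x|?M. trapezoid a b n x) / m"
    define \<psi> where "\<psi> = (\<lambda>x. trapezoid a b n x - r * \<beta> x)"
    have "\<exists>\<phi>. test_function l \<phi> \<psi>"
    proof (rule mean_zero_test_function[where a = "min a (l/4)" and b = "max b (3*l/4)"])
      show "continuous_on UNIV \<psi>"
        unfolding \<psi>_def \<beta>_def by (intro continuous_intros continuous_trapezoid)
      show "\<psi> x = 0" if "x \<notin> {min a (l/4)<..<max b (3*l/4)}" for x
      proof -
        have "x \<notin> {a<..<b}" "x \<notin> {l/4<..<3*l/4}" using that by auto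
        then show ?thesis by (simp add: \<psi>_def \<beta>_def trapezoid_outside)
      qed
      have "(LINT x|?M. \<psi> x) = (LINT x|?M. trapezoid a b n x) - r * m"
        unfolding \<psi>_def m_def \<beta>_def using Ti by (subst Bochner_Integration.integral_diff) auto
      then show "(LINT x|?M. \<psi> x) = 0" using \<open>m \<noteq> 0\<close> by (simp add: r_def)
    qed (use ab l in auto)
    then have "0 = (LINT x|?M. u x * \<psi> x)"
      using wd by (auto simp: is_weak_deriv_def)
    also have "\<dots> = (LINT x|?M. trapezoid a b n x * u x - r * (\<beta> x * u x))"
      by (rule Bochner_Integration.integral_cong) (auto simp: \<psi>_def algebra_simps)
    also have "\<dots> = (LINT x|?M. trapezoid a b n x * u x) - r * (LINT x|?M. \<beta> x * u x)"
      using Tui[OF u] by (subst Bochner_Integration.integral_diff) (auto simp: \<beta>_def)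
    also have "r * (LINT x|?M. \<beta> x * u x) = c * (LINT x|?M. trapezoid a b n x)"
      by (simp add: r_def c_def)
    also have "(LINT x|?M. trapezoid a b n x * u x) - \<dots>
        = (LINT x|?M. trapezoid a b n x * u x - c * trapezoid a b n x)"
      using Tui[OF u] Ti by (subst Bochner_Integration.integral_diff) auto
    also have "\<dots> = (LINT x|?M. trapezoid a b n x * (u x - c))"
      by (rule Bochner_Integration.integral_cong) (auto simp: algebra_simps)
    finally show ?thesis by simp
  qed
  have uc: "integrable ?M (\<lambda>x. u x - c)" using u by simp
  have "AE x in ?M. u x - c = 0"
  proof (rule AE_zero_of_interval_integrals_zero[OF uc])
    fix a b assume ab: "0 < a" "a < b" "b < l"
    have "(\<lambda>n. LINT x|?M. trapezoid a b n x * (u x - c)) \<longlonglongrightarrow> (LINT x|?M. indicator {a<..<b} x * (u x - c))"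
    proof (rule integral_dominated_convergence[where w = "\<lambda>x. \<bar>u x - c\<bar>"])
      show "AE x in ?M. norm (trapezoid a b n x * (u x - c)) \<le> \<bar>u x - c\<bar>" for n
      proof (rule AE_I2)
        fix x
        show "norm (trapezoid a b n x * (u x - c)) \<le> \<bar>u x - c\<bar>"
          by (simp add: abs_mult abs_trapezoid_le mult_left_le_one_le)
      qed
    qed (use Tui[OF uc] uc in \<open>auto intro!: borel_measurable_integrable integrable_edge_indicator_mult tendsto_mult trapezoid_LIMSEQ\<close>)
    then show "(LINT x|?M. indicator {a<..<b} x * (u x - c)) = 0"
      by (simp add: T[OF ab] tendsto_const_iff)
  qed
  then show ?thesis by auto
qed

lemma integrable_test_function_mult:
  assumes "test_function l \<phi> \<psi>" "integrable (edge_measure l) g"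
  shows "integrable (edge_measure l) (\<lambda>x. g x * \<phi> x)" "integrable (edge_measure l) (\<lambda>x. g x * \<psi> x)"
proof -
  have *: "integrable (edge_measure l) (\<lambda>x. g x * h x)" if h: "continuous_on UNIV h" for h :: "real \<Rightarrow> real"
  proof -
    obtain B where B: "\<And>x. x \<in> {0..l} \<Longrightarrow> \<bar>h x\<bar> \<le> B"
      using continuous_bounded_on_edge[OF h] by blast
    show ?thesis
    proof (rule Bochner_Integration.integrable_bound[of _ "\<lambda>x. B * g x"])
      show "AE x in edge_measure l. norm (g x * h x) \<le> norm (B * g x)"
      proof (rule AE_I2)
        fix x assume "x \<in> space (edge_measure l)"
        then have "\<bar>h x\<bar> \<le> \<bar>B\<bar>" using B[of x] by simp
        then show "norm (g x * h x) \<le> norm (B * g x)"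
          using mult_left_mono[of "\<bar>h x\<bar>" "\<bar>B\<bar>" "\<bar>g x\<bar>"] by (simp add: abs_mult mult.commute)
      qed
    qed (use assms(2) borel_measurable_edge_continuous[OF h] in auto)
  qed
  have "continuous_on UNIV \<phi>" "continuous_on UNIV \<psi>"
    using assms(1) by (auto simp: test_function_def intro: DERIV_continuous_on)
  then show "integrable (edge_measure l) (\<lambda>x. g x * \<phi> x)" "integrable (edge_measure l) (\<lambda>x. g x * \<psi> x)"
    using * by auto
qed

text \<open>The primitive of \<open>g1 - g2\<close> has weak derivative \<open>g1 - g2\<close> and
  also \<open>0\<close>, hence is constant. Its increments are the integrals of
  \<open>g1 - g2\<close> over intervals, which therefore vanish.\<close>

lemma is_weak_deriv_unique:
  assumes l: "0 < l" and g1: "integrable (edge_measure l) g1" and g2: "integrable (edge_measure l) g2"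
    and wd: "is_weak_deriv l f g1" "is_weak_deriv l f g2"
  shows "AE x in edge_measure l. g1 x = g2 x"
proof -
  let ?M = "edge_measure l"
  define v where "v = (\<lambda>x. g1 x - g2 x)"
  have v: "integrable ?M v" unfolding v_def using g1 g2 by simp
  define u where "u = primitive l v"
  have cu: "continuous_on UNIV u" unfolding u_def by (rule continuous_primitive[OF v])
  have wdv: "is_weak_deriv l u v" using is_weak_deriv_primitive[OF v, of 0] by (simp add: u_def)
  have "is_weak_deriv l u (\<lambda>_. 0)"
    unfolding is_weak_deriv_def
  proof (intro allI impI)
    fix \<phi> \<psi> assume t: "test_function l \<phi> \<psi>"
    have "(LINT x|?M. u x * \<psi> x) = - (LINT x|?M. v x * \<phi> x)"
      using wdv t by (auto simp: is_weak_deriv_def)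
    also have "(LINT x|?M. v x * \<phi> x) = (LINT x|?M. g1 x * \<phi> x) - (LINT x|?M. g2 x * \<phi> x)"
      unfolding v_def left_diff_distrib
      by (rule Bochner_Integration.integral_diff) (rule integrable_test_function_mult[OF t] g1 g2)+
    also have "\<dots> = 0" using wd t by (auto simp: is_weak_deriv_def)
    finally show "(LINT x|?M. u x * \<psi> x) = - (LINT x|?M. 0 * \<phi> x)" by simp
  qed
  then obtain c where c: "AE x in ?M. u x = c"
    using weak_deriv_zero_imp_constant[OF l integrable_edge_continuous[OF cu]] by blast
  have uc: "u x = c" if "x \<in> {0..l}" for x
    using edge_AE_eq_continuous[OF l _ _ c that] cu by (auto intro: continuous_on_subset)
  have "AE x in ?M. v x = 0"
  proof (rule AE_zero_of_interval_integrals_zero[OF v])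
    fix a b assume ab: "0 < a" "a < b" "b < l"
    have "(LINT t|?M. indicator {a<..<b} t * v t) = (LINT t|?M. indicator {a..<b} t * v t)"
    proof (rule integral_cong_AE)
      show "AE t in ?M. indicator {a<..<b} t * v t = indicator {a..<b} t * v t"
        using AE_edge_neq[where l = l and x = a] by eventually_elim (auto simp: indicator_def)
    qed (auto intro!: borel_measurable_integrable integrable_edge_indicator_mult v)
    also have "\<dots> = u b - u a" using primitive_diff[OF v, of a b] ab by (simp add: u_def)
    also have "\<dots> = 0" using uc ab by simp
    finally show "(LINT t|?M. indicator {a<..<b} t * v t) = 0" .
  qed
  then show ?thesis by (auto simp: v_def)
qed

section \<open>Square-integrable functions, continuous representatives and traces\<close>

lemma L2_edge_imp_integrable: "L2_edge l f \<Longrightarrow> integrable (edge_measure l) f"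
  using finite_measure.square_integrable_imp_integrable[OF finite_edge_measure] by (auto simp: L2_edge_def)

lemma L2_edge_bounded:
  assumes "f \<in> borel_measurable (edge_measure l)" "\<And>x. x \<in> {0<..<l} \<Longrightarrow> \<bar>f x\<bar> \<le> B"
  shows "L2_edge l f"
proof -
  interpret M: finite_measure "edge_measure l" by (rule finite_edge_measure)
  have "(f x)\<^sup>2 \<le> B\<^sup>2" if "x \<in> {0<..<l}" for x
    using order_trans[OF assms(2)[OF that] abs_ge_self] by (simp add: abs_le_square_iff)
  then have "integrable (edge_measure l) (\<lambda>x. (f x)\<^sup>2)"
    using assms(1) by (intro M.integrable_const_bound[where B = "B\<^sup>2"] AE_I2) auto
  then show ?thesis using assms(1) by (simp add: L2_edge_def)
qed

lemma L2_edge_cmult: "L2_edge l f \<Longrightarrow> L2_edge l (\<lambda>x. k * f x)"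
  by (auto simp: L2_edge_def power_mult_distrib)

lemma W12_edge_weak_deriv:
  assumes "W12_edge l f"
  shows "L2_edge l (weak_deriv l f)" "is_weak_deriv l f (weak_deriv l f)"
  using assms someI_ex[of "\<lambda>g. L2_edge l g \<and> is_weak_deriv l f g"]
  by (auto simp: W12_edge_def weak_deriv_def)

lemma weak_deriv_AE_eq:
  assumes "0 < l" "L2_edge l f" "L2_edge l g" "is_weak_deriv l f g"
  shows "W12_edge l f" "AE x in edge_measure l. weak_deriv l f x = g x"
proof -
  show W: "W12_edge l f" using assms by (auto simp: W12_edge_def)
  show "AE x in edge_measure l. weak_deriv l f x = g x"
    using W12_edge_weak_deriv[OF W] assms by (intro is_weak_deriv_unique L2_edge_imp_integrable)
qed

lemma trace_value_eq:
  assumes "0 < l" "continuous_on {0..l} w" "AE x in edge_measure l. w x = f x" "t \<in> {0..l}"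
  shows "trace_value l f t = w t"
  unfolding trace_value_def
proof (rule the_equality)
  fix c assume "\<exists>w'. continuous_on {0..l} w' \<and> (AE x in edge_measure l. w' x = f x) \<and> w' t = c"
  then obtain w' where w': "continuous_on {0..l} w'" "AE x in edge_measure l. w' x = f x" "w' t = c" by blast
  have "AE x in edge_measure l. w' x = w x" using w'(2) assms(3) by eventually_elim simp
  from edge_AE_eq_continuous[OF assms(1) w'(1) assms(2) this assms(4)] show "c = w t" using w'(3) by simp
qed (use assms in blast)

text \<open>Subtracting the primitive of the weak derivative leaves a function with weak derivative
  zero.\<close>

lemma W12_edge_representation:
  assumes l: "0 < l" and W: "W12_edge l f"
  obtains c where "AE x in edge_measure l. c + primitive l (weak_deriv l f) x = f x"
proof -
  let ?M = "edge_measure l" and ?g = "weak_deriv l f"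
  have g: "integrable ?M ?g" and wd: "is_weak_deriv l f ?g"
    using W12_edge_weak_deriv[OF W] by (auto intro: L2_edge_imp_integrable)
  have f: "integrable ?M f" using W by (auto simp: W12_edge_def intro: L2_edge_imp_integrable)
  define P where "P = primitive l ?g"
  have P: "integrable ?M P" and wdP: "is_weak_deriv l P ?g"
    using integrable_edge_continuous[OF continuous_primitive[OF g]] is_weak_deriv_primitive[OF g, of 0]
    by (auto simp: P_def)
  have "is_weak_deriv l (\<lambda>x. f x - P x) (\<lambda>_. 0)"
    unfolding is_weak_deriv_def
  proof (intro allI impI)
    fix \<phi> \<psi> assume t: "test_function l \<phi> \<psi>"
    have "(LINT x|?M. (f x - P x) * \<psi> x) = (LINT x|?M. f x * \<psi> x) - (LINT x|?M. P x * \<psi> x)"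
      unfolding left_diff_distrib
      by (rule Bochner_Integration.integral_diff) (rule integrable_test_function_mult[OF t] f P)+
    also have "\<dots> = 0" using wd wdP t by (auto simp: is_weak_deriv_def)
    finally show "(LINT x|?M. (f x - P x) * \<psi> x) = - (LINT x|?M. 0 * \<phi> x)" by simp
  qed
  then obtain c where "AE x in ?M. f x - P x = c"
    using weak_deriv_zero_imp_constant[OF l Bochner_Integration.integrable_diff[OF f P]] by blast
  then have "AE x in ?M. c + P x = f x" by eventually_elim simp
  then show thesis using that by (simp add: P_def)
qed

text \<open>Stated for all points of the closed edge because the traces at the division points, and
  not only those at the vertices, serve as a flow in \<open>cheeger_cut_condition\<close>.\<close>

lemma W12_edge_trace:
  assumes l: "0 < l" and W: "W12_edge l f"
  shows "continuous_on {0..l} (trace_value l f)"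
    and "AE x in edge_measure l. trace_value l f x = f x"
    and "\<lbrakk>0 \<le> x; x \<le> y; y \<le> l\<rbrakk> \<Longrightarrow> trace_value l f y - trace_value l f x
      = (LINT t|edge_measure l. indicator {x..<y} t * weak_deriv l f t)"
proof -
  obtain c where c: "AE x in edge_measure l. c + primitive l (weak_deriv l f) x = f x"
    using W12_edge_representation[OF assms] .
  have g: "integrable (edge_measure l) (weak_deriv l f)"
    using W12_edge_weak_deriv[OF W] by (auto intro: L2_edge_imp_integrable)
  define w where "w = (\<lambda>x. c + primitive l (weak_deriv l f) x)"
  have cw: "continuous_on {0..l} w"
    unfolding w_def by (intro continuous_intros continuous_on_subset[OF continuous_primitive[OF g]]) auto
  have tr: "trace_value l f t = w t" if "t \<in> {0..l}" for t
    using trace_value_eq[OF l cw _ that] c by (simp add: w_def)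
  show "continuous_on {0..l} (trace_value l f)"
    using cw tr by (subst continuous_on_cong[OF refl tr]) auto
  have "AE x in edge_measure l. trace_value l f x = w x"
    using tr by (intro AE_I2) auto
  then show "AE x in edge_measure l. trace_value l f x = f x"
    using c by eventually_elim (simp add: w_def)
  show "trace_value l f y - trace_value l f x
      = (LINT t|edge_measure l. indicator {x..<y} t * weak_deriv l f t)" if "0 \<le> x" "x \<le> y" "y \<le> l"
    using tr that primitive_diff[OF g, of x y] by (simp add: w_def)
qed

lemma W12_edge_trace_bound:
  assumes "0 < l" "W12_edge l f" "AE x in edge_measure l. \<bar>f x\<bar> \<le> C" "t \<in> {0..l}"
  shows "\<bar>trace_value l f t\<bar> \<le> C"
proof (rule edge_AE_le_continuous[OF assms(1) _ _ assms(4)])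
  show "continuous_on {0..l} (\<lambda>t. \<bar>trace_value l f t\<bar>)"
    by (intro continuous_intros W12_edge_trace assms)
  show "AE x in edge_measure l. \<bar>trace_value l f x\<bar> \<le> C"
    using W12_edge_trace(2)[OF assms(1,2)] assms(3) by eventually_elim simp
qed

lemma W12_edge_primitive:
  fixes c :: real
  assumes l: "0 < l" and g: "L2_edge l g"
  defines "f \<equiv> \<lambda>x. c + primitive l g x"
  shows "W12_edge l f" "AE x in edge_measure l. weak_deriv l f x = g x"
    and "t \<in> {0..l} \<Longrightarrow> trace_value l f t = f t"
proof -
  have gi: "integrable (edge_measure l) g" using g by (rule L2_edge_imp_integrable)
  have cf: "continuous_on UNIV f"
    unfolding f_def by (intro continuous_intros continuous_primitive[OF gi])
  obtain B where "\<And>x. x \<in> {0..l} \<Longrightarrow> \<bar>f x\<bar> \<le> B"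
    using continuous_bounded_on_edge[OF cf] by blast
  then have "L2_edge l f"
    by (intro L2_edge_bounded[where B = B] borel_measurable_edge_continuous[OF cf]) auto
  then show "W12_edge l f" "AE x in edge_measure l. weak_deriv l f x = g x"
    using weak_deriv_AE_eq[OF l _ g] is_weak_deriv_primitive[OF gi] by (auto simp: f_def)
  show "t \<in> {0..l} \<Longrightarrow> trace_value l f t = f t"
    by (intro trace_value_eq l continuous_on_subset[OF cf]) auto
qed

lemma W12_edge_cmult:
  assumes l: "0 < l" and W: "W12_edge l f"
  shows "W12_edge l (\<lambda>x. k * f x)"
    and "AE x in edge_measure l. weak_deriv l (\<lambda>x. k * f x) x = k * weak_deriv l f x"
    and "t \<in> {0..l} \<Longrightarrow> trace_value l (\<lambda>x. k * f x) t = k * trace_value l f t"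
proof -
  have wd: "is_weak_deriv l (\<lambda>x. k * f x) (\<lambda>x. k * weak_deriv l f x)"
    using W12_edge_weak_deriv(2)[OF W] by (auto simp: is_weak_deriv_def mult.assoc)
  show "W12_edge l (\<lambda>x. k * f x)"
    "AE x in edge_measure l. weak_deriv l (\<lambda>x. k * f x) x = k * weak_deriv l f x"
    using weak_deriv_AE_eq[OF l _ _ wd] W W12_edge_weak_deriv(1)[OF W]
    by (auto simp: W12_edge_def intro!: L2_edge_cmult)
  have "AE x in edge_measure l. k * trace_value l f x = k * f x"
    using W12_edge_trace(2)[OF l W] by eventually_elim simp
  then show "t \<in> {0..l} \<Longrightarrow> trace_value l (\<lambda>x. k * f x) t = k * trace_value l f t"
    by (intro trace_value_eq l continuous_intros W12_edge_trace W)
qed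

section \<open>Interpolation on a partition into cells\<close>

text \<open>Half-open cells partition \<open>[0, l)\<close>, so that a point has exactly one cell
  index, given by a floor.\<close>

abbreviation cell :: "real \<Rightarrow> nat \<Rightarrow> nat \<Rightarrow> real set" where
  "cell l n k \<equiv> {real k * l / real n ..< real (Suc k) * l / real n}"

lemma mem_cell_iff:
  assumes "0 < l" "0 < n" "0 \<le> x"
  shows "x \<in> cell l n k \<longleftrightarrow> k = nat \<lfloor>x * real n / l\<rfloor>"
proof -
  have "x \<in> cell l n k \<longleftrightarrow> real k \<le> x * real n / l \<and> x * real n / l < real k + 1"
    using assms by (auto simp: field_simps)
  also have "\<dots> \<longleftrightarrow> \<lfloor>x * real n / l\<rfloor> = int k"
    by (simp add: floor_eq_iff)
  also have "\<dots> \<longleftrightarrow> k = nat \<lfloor>x * real n / l\<rfloor>"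
    using assms by auto
  finally show ?thesis .
qed

lemma cell_index_less:
  assumes "0 < l" "0 < n" "x < l"
  shows "nat \<lfloor>x * real n / l\<rfloor> < n"
proof -
  have "x * real n / l < real n" using assms by (simp add: field_simps)
  then have "\<lfloor>x * real n / l\<rfloor> < int n" by (simp add: floor_less_iff)
  then show ?thesis using assms(2) by linarith
qed

lemma cell_points_le:
  assumes "0 < l" "0 < n" "k \<le> n"
  shows "0 \<le> real k * l / real n" "real k * l / real n \<le> l" "real k * l / real n \<le> real (Suc k) * l / real n"
  using assms by (auto simp: field_simps)

lemma integral_edge_indicator_Ico:
  assumes "0 \<le> a" "a \<le> b" "b \<le> l"
  shows "(LINT x|edge_measure l. indicator {a..<b} x) = (b - a :: real)"
proof -
  have "(LINT x|edge_measure l. indicator {a..<b} x :: real) = (LINT x|lebesgue. indicator {0<..<l} x * indicator {a..<b} x)"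
    by (subst integral_restrict_space) auto
  also have "\<dots> = (LINT x|lebesgue. indicator {a<..<b} x)"
  proof (rule integral_cong_AE)
    have "AE x in lebesgue. x \<noteq> a" by (auto intro: AE_I'[of "{a}"])
    then show "AE x in lebesgue. indicator {0<..<l} x * indicator {a..<b} x = (indicator {a<..<b} x :: real)"
      by eventually_elim (use assms in \<open>auto simp: indicator_def\<close>)
  qed (auto intro!: borel_measurable_times borel_measurable_indicator)
  also have "\<dots> = b - a" using assms by simp
  finally show ?thesis .
qed

text \<open>At almost every point only the summand of the cell containing it can survive. The
  hypothesis on \<open>E\<close> tolerates null sets, since a cell may lie in \<Omega> only up to a
  null set.\<close>

lemma integral_union_of_cells:
  fixes g :: "real \<Rightarrow> real"
  assumes l: "0 < l" and n: "0 < n" and E: "E \<in> sets lebesgue"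
    and ind: "AE x in edge_measure l. x \<in> E \<longleftrightarrow> P (nat \<lfloor>x * real n / l\<rfloor>)"
    and g: "integrable (edge_measure l) g"
  shows "(LINT x|edge_measure l. indicator E x * g x)
    = (\<Sum>k<n. of_bool (P k) * (LINT x|edge_measure l. indicator (cell l n k) x * g x))"
proof -
  let ?M = "edge_measure l"
  have int: "integrable ?M (\<lambda>x. indicator (cell l n k) x * g x)" for k
    by (rule integrable_edge_indicator_mult[OF g]) simp
  have "(LINT x|?M. indicator E x * g x) = (LINT x|?M. (\<Sum>k<n. of_bool (P k) * (indicator (cell l n k) x * g x)))"
  proof (rule integral_cong_AE)
    have "AE x in ?M. x \<in> {0<..<l}" by (rule AE_I2) simp
    then show "AE x in ?M. indicator E x * g x = (\<Sum>k<n. of_bool (P k) * (indicator (cell l n k) x * g x))"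
      using ind
    proof eventually_elim
      case (elim x)
      have "(\<Sum>k<n. of_bool (P k) * (indicator (cell l n k) x * g x))
          = (\<Sum>k<n. if k = nat \<lfloor>x * real n / l\<rfloor> then of_bool (P k) * g x else 0)"
        using elim l n mem_cell_iff[of l n x] by (intro sum.cong) (auto simp: indicator_def)
      also have "\<dots> = of_bool (P (nat \<lfloor>x * real n / l\<rfloor>)) * g x"
        using cell_index_less[OF l n, of x] elim(1) by simp
      finally have eq: "(\<Sum>k<n. of_bool (P k) * (indicator (cell l n k) x * g x)) = \<dots>" .
      show ?case unfolding eq using elim(2) by (simp add: indicator_def)
    qed
    show "(\<lambda>x. indicator E x * g x) \<in> borel_measurable ?M"
      by (intro borel_measurable_integrable integrable_edge_indicator_mult g E)
    show "(\<lambda>x. \<Sum>k<n. of_bool (P k) * (indicator (cell l n k) x * g x)) \<in> borel_measurable ?M"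
      by (intro borel_measurable_integrable Bochner_Integration.integrable_sum integrable_mult_right int)
  qed
  also have "\<dots> = (\<Sum>k<n. of_bool (P k) * (LINT x|?M. indicator (cell l n k) x * g x))"
    using int by (simp only: Bochner_Integration.integral_sum integrable_mult_right integral_mult_right_zero)
  finally show ?thesis .
qed

text \<open>On a cell not contained in \<open>B\<close> the slope off \<open>B\<close> is free, and it is chosen to reach the prescribed
  value at the right end. The derivative then has a sign or is at most \<open>1\<close> on the cell, so that
  \<open>w\<close> overshoots its values at the ends of the cell by at most the length of the cell.\<close>

lemma W12_edge_interpolation:
  assumes l: "0 < l" and n: "0 < n" and B: "B \<in> sets lebesgue"
    and bound: "\<And>k. k \<le> n \<Longrightarrow> \<bar>F k\<bar> \<le> C"
    and full: "\<And>k. k < n \<Longrightarrow> AE x in edge_measure l. x \<in> cell l n k \<longrightarrow> x \<in> B \<Longrightarrow> F (Suc k) - F k = l / n"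
  obtains w where "W12_edge l w" and "AE x in edge_measure l. x \<in> B \<longrightarrow> weak_deriv l w x = 1"
    and "trace_value l w 0 = F 0" and "trace_value l w l = F n"
    and "\<And>x. x \<in> {0<..<l} \<Longrightarrow> \<bar>w x\<bar> \<le> C + l / n"
proof -
  let ?M = "edge_measure l"
  interpret M: finite_measure ?M by (rule finite_edge_measure)
  define pt where "pt k = real k * l / real n" for k
  \<comment> \<open>\<open>a k\<close> and \<open>b k\<close> are the lengths of the parts of the
    cell in and off \<open>B\<close>. With slope \<open>1\<close> on \<open>B\<close>, the slope
    \<open>\<kappa> k\<close> off \<open>B\<close> has to supply the rest of the increment.\<close>
  define a b :: "nat \<Rightarrow> real" where "a = (\<lambda>k. LINT x|?M. indicator (cell l n k \<inter> B) x)"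
    and "b = (\<lambda>k. LINT x|?M. indicator (cell l n k - B) x)"
  define \<kappa> where "\<kappa> = (\<lambda>k. (F (Suc k) - F k - a k) / b k)"
  define g :: "real \<Rightarrow> real" where
    "g = (\<lambda>x. indicator B x + indicator (- B) x * (\<Sum>k<n. \<kappa> k * indicator (cell l n k) x))"
  have int_ind: "integrable ?M (indicator A :: real \<Rightarrow> real)" if "A \<in> sets lebesgue" for A
    using that by (intro M.integrable_const_bound[where B = 1] AE_I2) (auto simp: indicator_def borel_measurable_edge_indicator)
  have sets: "cell l n k \<inter> B \<in> sets lebesgue" "cell l n k - B \<in> sets lebesgue" for k
    using B by auto
  have ab: "a k + b k = l / n" if k: "k < n" for k
  proof -
    have "a k + b k = (LINT x|?M. indicator (cell l n k \<inter> B) x + indicator (cell l n k - B) x)"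
      unfolding a_def b_def by (rule Bochner_Integration.integral_add[symmetric]) (intro int_ind sets)+
    also have "\<dots> = (LINT x|?M. indicator (cell l n k) x)"
      by (rule Bochner_Integration.integral_cong) (auto simp: indicator_def)
    also have "\<dots> = l / n"
      using k l n cell_points_le[OF l n, of k] cell_points_le(2)[OF l n, of "Suc k"]
      by (subst integral_edge_indicator_Ico) (auto simp: field_simps)
    finally show ?thesis .
  qed
  have increment: "a k + \<kappa> k * b k = F (Suc k) - F k" if k: "k < n" for k
  proof (cases "b k = 0")
    \<comment> \<open>There is no room off \<open>B\<close>: the cell lies in \<open>B\<close> up to
      a null set, and the increment is the one that \<open>full\<close> prescribes.\<close>
    case True
    then have "AE x in ?M. (indicator (cell l n k - B) x :: real) = 0"
      unfolding b_def using int_ind[OF sets(2)] by (subst (asm) integral_nonneg_eq_0_iff_AE) auto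
    then have "AE x in ?M. x \<in> cell l n k \<longrightarrow> x \<in> B"
      by eventually_elim (auto simp: indicator_def split: if_splits)
    from full[OF k this] show ?thesis using ab[OF k] True by simp
  next
    case False
    then show ?thesis by (simp add: \<kappa>_def)
  qed
  have g_cell: "g x = indicator B x + indicator (- B) x * \<kappa> k" if "k < n" "x \<in> cell l n k" for x k
  proof -
    have x: "0 \<le> x" using that cell_points_le[OF l n, of k] by auto
    have "(\<Sum>j<n. \<kappa> j * indicator (cell l n j) x) = (\<Sum>j<n. if j = k then \<kappa> k else 0)"
      using that mem_cell_iff[OF l n x] by (intro sum.cong) (auto simp: indicator_def)
    then show ?thesis using that by (simp add: g_def)
  qed
  have gm: "g \<in> borel_measurable ?M"
    unfolding g_def using B
    by (intro borel_measurable_add borel_measurable_times borel_measurable_sum borel_measurable_const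
        borel_measurable_edge_indicator) (auto simp: Compl_in_sets_lebesgue)
  have gb: "\<bar>g x\<bar> \<le> 1 + (\<Sum>k<n. \<bar>\<kappa> k\<bar>)" for x
  proof -
    have "\<bar>\<Sum>k<n. \<kappa> k * indicator (cell l n k) x\<bar> \<le> (\<Sum>k<n. \<bar>\<kappa> k\<bar>)"
      by (rule order_trans[OF sum_abs sum_mono]) (auto simp: indicator_def)
    then show ?thesis by (auto simp: g_def indicator_def sum_nonneg)
  qed
  have g2: "L2_edge l g" by (rule L2_edge_bounded[OF gm gb])
  have gi: "integrable ?M g" by (rule L2_edge_imp_integrable[OF g2])
  define w where "w = (\<lambda>x. F 0 + primitive l g x)"
  have w_diff: "w y - w x = (LINT t|?M. indicator {x..<y} t * g t)" if "x \<le> y" for x y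
    using primitive_diff[OF gi that] by (simp add: w_def)
  have step: "w (pt (Suc k)) - w (pt k) = F (Suc k) - F k" if k: "k < n" for k
  proof -
    have "w (pt (Suc k)) - w (pt k) = (LINT t|?M. indicator (cell l n k) t * g t)"
      using w_diff[of "pt k" "pt (Suc k)"] cell_points_le(3)[OF l n, of k] k by (simp add: pt_def)
    also have "\<dots> = (LINT t|?M. indicator (cell l n k \<inter> B) t + \<kappa> k * indicator (cell l n k - B) t)"
      by (rule Bochner_Integration.integral_cong) (use g_cell[OF k] in \<open>auto simp: indicator_def\<close>)
    also have "\<dots> = a k + \<kappa> k * b k"
      unfolding a_def b_def using int_ind[OF sets(1)] int_ind[OF sets(2)]
      by (subst Bochner_Integration.integral_add) auto
    finally show ?thesis using increment[OF k] by simp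
  qed
  have w_pt: "w (pt k) = F k" if "k \<le> n" for k
    using that
  proof (induction k)
    case 0
    then show ?case by (simp add: w_def pt_def primitive_0)
  next
    case (Suc k)
    then show ?case using step[of k] by simp
  qed
  have w_bound: "\<bar>w x\<bar> \<le> C + l / n" if x: "x \<in> {0<..<l}" for x
  proof -
    define k where "k = nat \<lfloor>x * real n / l\<rfloor>"
    have k: "k < n" using cell_index_less[OF l n, of x] x by (simp add: k_def)
    have xk: "x \<in> cell l n k" using mem_cell_iff[OF l n, of x k] x by (simp add: k_def)
    have pts: "0 \<le> pt k" "pt (Suc k) \<le> l" "pt k \<le> x" "x \<le> pt (Suc k)" "pt (Suc k) - pt k = l / n"
      using cell_points_le[OF l n, of k] cell_points_le[OF l n, of "Suc k"] k xk
      by (auto simp: pt_def field_simps)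
    have FC: "\<bar>w (pt k)\<bar> \<le> C" "\<bar>w (pt (Suc k))\<bar> \<le> C" using w_pt bound k by auto
    have sub: "{pt k..<x} \<subseteq> cell l n k" "{x..<pt (Suc k)} \<subseteq> cell l n k"
      using xk by (auto simp: pt_def)
    show ?thesis
    proof (cases "\<kappa> k \<ge> 0")
      \<comment> \<open>Here \<open>g \<ge> 0\<close> on the cell, so \<open>w\<close> is monotone
        there and stays between its values at the two ends.\<close>
      case True
      have "0 \<le> w v - w u" if uv: "u \<le> v" "{u..<v} \<subseteq> cell l n k" for u v
      proof -
        have "0 \<le> indicator {u..<v} t * g t" for t
          using uv(2) g_cell[OF k, of t] True by (cases "t \<in> {u..<v}") (auto simp: subset_iff)
        then show ?thesis unfolding w_diff[OF uv(1)] by (intro integral_nonneg_AE AE_I2)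
      qed
      from this[OF pts(3) sub(1)] this[OF pts(4) sub(2)] show ?thesis
        using FC l n by (auto simp: abs_le_iff intro: add_increasing2)
    next
      \<comment> \<open>Here \<open>g \<le> 1\<close> on the cell, so \<open>w\<close> rises by at
        most \<open>l / n\<close> there: the left end bounds it from above and the right end from
        below.\<close>
      case False
      have "w v - w u \<le> v - u" if uv: "u \<le> v" "{u..<v} \<subseteq> cell l n k" "0 \<le> u" "v \<le> l" for u v
      proof -
        have "indicator {u..<v} t * g t \<le> indicator {u..<v} t" for t
          using uv(2) g_cell[OF k, of t] False
          by (cases "t \<in> {u..<v}"; cases "t \<in> B") (auto simp: subset_iff)
        then have "(LINT t|?M. indicator {u..<v} t * g t) \<le> (LINT t|?M. indicator {u..<v} t)"
          by (intro integral_mono integrable_edge_indicator_mult gi int_ind) auto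
        then show ?thesis
          unfolding w_diff[OF uv(1)] integral_edge_indicator_Ico[OF uv(3,1,4)] .
      qed
      from this[OF pts(3) sub(1)] this[OF pts(4) sub(2)] show ?thesis
        using FC pts x by (auto simp: abs_le_iff)
    qed
  qed
  have wd: "W12_edge l w" "AE x in ?M. weak_deriv l w x = g x"
    unfolding w_def by (rule W12_edge_primitive[OF l g2])+
  have tr: "trace_value l w t = w t" if "t \<in> {0..l}" for t
    unfolding w_def using W12_edge_primitive(3)[OF l g2 that] by simp
  show thesis
  proof (rule that[OF wd(1)])
    show "AE x in ?M. x \<in> B \<longrightarrow> weak_deriv l w x = 1"
      using wd(2) by eventually_elim (auto simp: g_def)
    show "trace_value l w 0 = F 0" using tr[of 0] l w_pt[of 0] by (simp add: pt_def)
    show "trace_value l w l = F n" using tr[of l] l n w_pt[of n] by (simp add: pt_def)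
  qed (rule w_bound)
qed

section \<open>Flows with prescribed net outflow\<close>

definition net_outflow :: "('a \<Rightarrow> 'n) \<Rightarrow> ('a \<Rightarrow> 'n) \<Rightarrow> 'a set \<Rightarrow> ('a \<Rightarrow> real) \<Rightarrow> 'n \<Rightarrow> real" where
  "net_outflow t h A f v = (\<Sum>a\<in>A. f a * (of_bool (t a = v) - of_bool (h a = v)))"

lemma sum_net_outflow:
  assumes "finite S"
  shows "(\<Sum>v\<in>S. net_outflow t h A f v) = (\<Sum>a\<in>A. f a * (of_bool (t a \<in> S) - of_bool (h a \<in> S)))"
proof -
  have *: "(\<Sum>v\<in>S. of_bool (x = v)) = (of_bool (x \<in> S) :: real)" for x
    using assms by (simp add: of_bool_def)
  have "(\<Sum>v\<in>S. net_outflow t h A f v) = (\<Sum>a\<in>A. \<Sum>v\<in>S. f a * (of_bool (t a = v) - of_bool (h a = v)))"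
    unfolding net_outflow_def by (rule sum.swap)
  also have "\<dots> = (\<Sum>a\<in>A. f a * (of_bool (t a \<in> S) - of_bool (h a \<in> S)))"
    by (simp only: sum_distrib_left[symmetric] sum_subtractf *)
  finally show ?thesis .
qed

lemma net_outflow_upd:
  assumes "finite A" "a \<in> A"
  shows "net_outflow t h A (f(a := f a + \<epsilon>)) v = net_outflow t h A f v + \<epsilon> * (of_bool (t a = v) - of_bool (h a = v))"
proof -
  have "net_outflow t h A (f(a := f a + \<epsilon>)) v
      = (\<Sum>b\<in>A. f b * (of_bool (t b = v) - of_bool (h b = v))
          + (if b = a then \<epsilon> * (of_bool (t a = v) - of_bool (h a = v)) else 0))"
    unfolding net_outflow_def by (rule sum.cong) (auto simp: algebra_simps)
  then show ?thesis using assms by (simp add: sum.distrib net_outflow_def)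
qed

text \<open>Tychonoff's theorem. Flows are functions on the whole type, so the product topology
  replaces a finite-dimensional space.\<close>

lemma compact_cube: "compact {f :: 'a \<Rightarrow> real. \<forall>a. \<bar>f a\<bar> \<le> 1}"
proof -
  have "compactin (product_topology (\<lambda>_. euclidean) UNIV) (\<Pi>\<^sub>E a\<in>(UNIV :: 'a set). {-1..1::real})"
    by (subst compactin_PiE) auto
  moreover have "(\<Pi>\<^sub>E a\<in>(UNIV :: 'a set). {-1..1::real}) = {f. \<forall>a. \<bar>f a\<bar> \<le> 1}"
    by (auto simp: PiE_def Pi_def abs_le_iff minus_le_iff)
  ultimately show ?thesis
    by (simp add: euclidean_product_topology compactin_euclidean_iff)
qed

text \<open>Nodes outside \<open>N\<close> are unconstrained. If \<open>f\<close>
  minimises the squared defect and \<open>p\<close> is its defect, the first-order conditions say that every arc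
  leaving \<open>{p > 0}\<close> is saturated, so that the cut condition fails unless this set is empty.\<close>

lemma supply_demand:
  fixes t h :: "'a \<Rightarrow> 'n" and d :: "'n \<Rightarrow> real"
  assumes A: "finite A" and N: "finite N" and d: "\<And>v. v \<in> N \<Longrightarrow> 0 \<le> d v"
    and cut: "\<And>S. S \<subseteq> N \<Longrightarrow> sum d S \<le> real (card {a \<in> A. (t a \<in> S) \<noteq> (h a \<in> S)})"
  obtains f where "\<And>a. \<bar>f a\<bar> \<le> 1" and "\<And>v. v \<in> N \<Longrightarrow> net_outflow t h A f v = d v"
proof -
  define K where "K = {f :: 'a \<Rightarrow> real. \<forall>a. \<bar>f a\<bar> \<le> 1}"
  define \<Phi> where "\<Phi> = (\<lambda>f. \<Sum>v\<in>N. (d v - net_outflow t h A f v)\<^sup>2)"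
  have coord: "continuous_on UNIV (\<lambda>f :: 'a \<Rightarrow> real. f a)" for a
    by (rule continuous_on_product_coordinates)
  have "continuous_on UNIV \<Phi>"
    unfolding \<Phi>_def net_outflow_def by (intro continuous_intros coord)
  then have cont: "continuous_on K \<Phi>" by (rule continuous_on_subset) simp
  have "(\<lambda>_. 0) \<in> K" by (simp add: K_def)
  then have "K \<noteq> {}" by blast
  moreover have "compact K" unfolding K_def by (rule compact_cube)
  ultimately obtain f where f: "f \<in> K" and min: "\<And>g. g \<in> K \<Longrightarrow> \<Phi> f \<le> \<Phi> g"
    using continuous_attains_inf[OF _ _ cont] by blast
  \<comment> \<open>Unconstrained nodes get defect \<open>0\<close>. They thus stay out of the sets
    \<open>{p > 0}\<close> and \<open>{p < 0}\<close>, to which the cut estimates are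
    applied.\<close>
  define p where "p = (\<lambda>v. if v \<in> N then d v - net_outflow t h A f v else 0)"
  \<comment> \<open>Changing the flow on the single arc \<open>a\<close> by \<epsilon> changes
    \<open>\<Phi>\<close> by a quadratic polynomial in \<epsilon>, which minimality keeps
    nonnegative.\<close>
  have first_order: "2 * \<epsilon> * (p (t a) - p (h a)) \<le> \<epsilon>\<^sup>2 * (\<Sum>v\<in>N. (of_bool (t a = v) - of_bool (h a = v))\<^sup>2)"
    if a: "a \<in> A" and \<epsilon>: "\<bar>f a + \<epsilon>\<bar> \<le> 1" for a \<epsilon>
  proof -
    define \<delta> :: "'n \<Rightarrow> real" where "\<delta> = (\<lambda>v. of_bool (t a = v) - of_bool (h a = v))"
    have "f(a := f a + \<epsilon>) \<in> K" using f \<epsilon> by (auto simp: K_def)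
    then have "\<Phi> f \<le> \<Phi> (f(a := f a + \<epsilon>))" by (rule min)
    also have "\<dots> = (\<Sum>v\<in>N. (d v - net_outflow t h A f v)\<^sup>2 - 2 * \<epsilon> * (p v * \<delta> v) + \<epsilon>\<^sup>2 * (\<delta> v)\<^sup>2)"
      unfolding \<Phi>_def net_outflow_upd[OF A a] \<delta>_def
      by (rule sum.cong) (auto simp: p_def power2_eq_square algebra_simps)
    also have "\<dots> = \<Phi> f - 2 * \<epsilon> * (\<Sum>v\<in>N. p v * \<delta> v) + \<epsilon>\<^sup>2 * (\<Sum>v\<in>N. (\<delta> v)\<^sup>2)"
      by (simp add: sum.distrib sum_subtractf sum_distrib_left \<Phi>_def)
    finally have "2 * \<epsilon> * (\<Sum>v\<in>N. p v * \<delta> v) \<le> \<epsilon>\<^sup>2 * (\<Sum>v\<in>N. (\<delta> v)\<^sup>2)" by simp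
    moreover have "(\<Sum>v\<in>N. p v * \<delta> v) = p (t a) - p (h a)"
    proof -
      have *: "(\<Sum>v\<in>N. p v * of_bool (x = v)) = p x" for x
        using N by (auto simp: of_bool_def p_def if_distrib[of "(*) _"] cong: if_cong)
      show ?thesis by (simp add: \<delta>_def right_diff_distrib sum_subtractf *)
    qed
    ultimately show ?thesis by (simp add: \<delta>_def)
  qed
  \<comment> \<open>For small \<epsilon> a positive linear term beats the quadratic one, which
    contradicts \<open>first_order\<close> as long as the arc has spare capacity.\<close>
  have small: "\<exists>\<epsilon>>0. \<epsilon> \<le> c \<and> \<not> 2 * q \<le> \<epsilon> * D" if "0 < q" "0 < c" "0 \<le> D" for q c D :: real
  proof (intro exI conjI)
    let ?\<epsilon> = "min c (q / (D + 1))"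
    show "0 < ?\<epsilon>" "?\<epsilon> \<le> c" using that by auto
    have "?\<epsilon> * D \<le> q / (D + 1) * D" using that by (intro mult_right_mono) auto
    also have "\<dots> \<le> q" using that by (simp add: field_simps)
    finally show "\<not> 2 * q \<le> ?\<epsilon> * D" using that by simp
  qed
  have sat_pos: "f a = 1" if a: "a \<in> A" and p: "p (h a) < p (t a)" for a
  proof (rule ccontr)
    let ?D = "\<Sum>v\<in>N. (of_bool (t a = v) - of_bool (h a = v) :: real)\<^sup>2"
    have fa: "\<bar>f a\<bar> \<le> 1" using f by (simp add: K_def)
    assume "f a \<noteq> 1"
    with fa have "0 < 1 - f a" by linarith
    then obtain \<epsilon> where \<epsilon>: "\<epsilon> > 0" "\<epsilon> \<le> 1 - f a" "\<not> 2 * (p (t a) - p (h a)) \<le> \<epsilon> * ?D"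
      using small[of "p (t a) - p (h a)" "1 - f a" ?D] p by (auto simp: sum_nonneg)
    have "\<epsilon> * (2 * (p (t a) - p (h a))) \<le> \<epsilon> * (\<epsilon> * ?D)"
      using first_order[OF a, of \<epsilon>] \<epsilon>(1,2) fa by (simp add: power2_eq_square algebra_simps)
    with \<epsilon> show False by simp
  qed
  have sat_neg: "f a = - 1" if a: "a \<in> A" and p: "p (t a) < p (h a)" for a
  proof (rule ccontr)
    let ?D = "\<Sum>v\<in>N. (of_bool (t a = v) - of_bool (h a = v) :: real)\<^sup>2"
    have fa: "\<bar>f a\<bar> \<le> 1" using f by (simp add: K_def)
    assume "f a \<noteq> - 1"
    with fa have "0 < 1 + f a" by linarith
    then obtain \<epsilon> where \<epsilon>: "\<epsilon> > 0" "\<epsilon> \<le> 1 + f a" "\<not> 2 * (p (h a) - p (t a)) \<le> \<epsilon> * ?D"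
      using small[of "p (h a) - p (t a)" "1 + f a" ?D] p by (auto simp: sum_nonneg)
    have "\<epsilon> * (2 * (p (h a) - p (t a))) \<le> \<epsilon> * (\<epsilon> * ?D)"
      using first_order[OF a, of "- \<epsilon>"] \<epsilon>(1,2) fa by (simp add: power2_eq_square algebra_simps)
    with \<epsilon> show False by simp
  qed
  have defect: "sum p S = sum d S - (\<Sum>a\<in>A. f a * (of_bool (t a \<in> S) - of_bool (h a \<in> S)))"
    if S: "S \<subseteq> N" for S
  proof -
    have "sum p S = (\<Sum>v\<in>S. d v - net_outflow t h A f v)"
      by (rule sum.cong) (use S in \<open>auto simp: p_def\<close>)
    then show ?thesis
      using sum_net_outflow[OF finite_subset[OF S N]] by (simp add: sum_subtractf)
  qed
  have "p v = 0" if v: "v \<in> N" for v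
  proof (rule ccontr)
    assume "p v \<noteq> 0"
    then consider "p v > 0" | "p v < 0" by linarith
    then show False
    proof cases
      case 1
      \<comment> \<open>Every arc crossing the boundary of \<open>S\<close> carries one unit
        outwards, so the net outflow of \<open>S\<close> is the size of the cut, which is at least
        the demand. The total defect of \<open>S\<close> would then be at most
        \<open>0\<close>.\<close>
      define S where "S = {v \<in> N. p v > 0}"
      have S: "S \<subseteq> N" by (auto simp: S_def)
      have out: "p x \<le> 0" if "x \<notin> S" for x using that by (auto simp: S_def p_def)
      have inn: "p x > 0" if "x \<in> S" for x using that by (auto simp: S_def)
      have "(\<Sum>a\<in>A. f a * (of_bool (t a \<in> S) - of_bool (h a \<in> S)))
          = (\<Sum>a\<in>A. of_bool ((t a \<in> S) \<noteq> (h a \<in> S)))"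
      proof (rule sum.cong)
        fix a assume a: "a \<in> A"
        show "f a * (of_bool (t a \<in> S) - of_bool (h a \<in> S)) = (of_bool ((t a \<in> S) \<noteq> (h a \<in> S)) :: real)"
          using sat_pos[OF a] sat_neg[OF a] out[of "t a"] out[of "h a"] inn[of "t a"] inn[of "h a"]
          by (cases "t a \<in> S"; cases "h a \<in> S") auto
      qed simp
      also have "\<dots> = real (card {a \<in> A. (t a \<in> S) \<noteq> (h a \<in> S)})"
        using A by (simp add: sum_of_bool_eq Int_def)
      finally have "sum p S \<le> 0" using defect[OF S] cut[OF S] by simp
      moreover have "sum p S > 0"
        using 1 v N by (intro sum_pos) (auto simp: S_def)
      ultimately show False by simp
    next
      case 2
      \<comment> \<open>Now all crossing arcs are saturated inwards, so the net outflow of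
        \<open>S\<close> is at most \<open>0\<close>, while the demands are nonnegative. The total
        defect would then be at least \<open>0\<close>.\<close>
      define S where "S = {v \<in> N. p v < 0}"
      have S: "S \<subseteq> N" by (auto simp: S_def)
      have out: "p x \<ge> 0" if "x \<notin> S" for x using that by (auto simp: S_def p_def)
      have inn: "p x < 0" if "x \<in> S" for x using that by (auto simp: S_def)
      have "(\<Sum>a\<in>A. f a * (of_bool (t a \<in> S) - of_bool (h a \<in> S))) \<le> 0"
      proof (rule sum_nonpos)
        fix a assume a: "a \<in> A"
        show "f a * (of_bool (t a \<in> S) - of_bool (h a \<in> S)) \<le> 0"
          using sat_pos[OF a] sat_neg[OF a] out[of "t a"] out[of "h a"] inn[of "t a"] inn[of "h a"]
          by (cases "t a \<in> S"; cases "h a \<in> S") auto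
      qed
      moreover have "0 \<le> sum d S" using d S by (intro sum_nonneg) auto
      ultimately have "sum p S \<ge> 0" using defect[OF S] by simp
      moreover have "sum p S < 0"
        using 2 v N sum_pos[of S "\<lambda>v. - p v"] by (force simp: S_def sum_negf)
      ultimately show False by simp
    qed
  qed
  then show thesis using that[of f] f by (auto simp: K_def p_def split: if_splits)
qed

section \<open>The Cheeger constant of a metric graph\<close>

text \<open>
  Every edge is cut into \<open>n\<close> cells of equal length. The division point \<open>k * len e / n\<close> of \<open>e\<close> is
  the arc \<open>(e, k)\<close> of an auxiliary network whose nodes are the vertices \<open>Inl v\<close> and the cells
  \<open>Inr (e, k)\<close>; the flow through an arc is the value of \<open>z\<close> at the point. The net outflow of a
  cell is the increment of \<open>z\<close> over it, and that of a vertex is minus its Kirchhoff sum.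
\<close>

definition subdivision_tail :: "('v, 'e) pre_digraph \<Rightarrow> 'e \<times> nat \<Rightarrow> 'v + 'e \<times> nat" where
  "subdivision_tail G = (\<lambda>(e, k). if k = 0 then Inl (tail G e) else Inr (e, k - 1))"

definition subdivision_head :: "('v, 'e) pre_digraph \<Rightarrow> nat \<Rightarrow> 'e \<times> nat \<Rightarrow> 'v + 'e \<times> nat" where
  "subdivision_head G n = (\<lambda>(e, k). if k = n then Inl (head G e) else Inr (e, k))"

abbreviation subdivision_outflow ::
    "('v, 'e) pre_digraph \<Rightarrow> nat \<Rightarrow> ('e \<times> nat \<Rightarrow> real) \<Rightarrow> 'v + 'e \<times> nat \<Rightarrow> real" where
  "subdivision_outflow G n \<equiv> net_outflow (subdivision_tail G) (subdivision_head G n) (arcs G \<times> {..n})"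

lemma subdivision_outflow_vertex:
  "subdivision_outflow G n f (Inl v)
    = (\<Sum>e\<in>arcs G. of_bool (tail G e = v) * f (e, 0) - of_bool (head G e = v) * f (e, n))"
proof -
  have "subdivision_outflow G n f (Inl v)
      = (\<Sum>e\<in>arcs G. \<Sum>k\<le>n. f (e, k) * (of_bool (subdivision_tail G (e, k) = Inl v) - of_bool (subdivision_head G n (e, k) = Inl v)))"
    unfolding net_outflow_def by (simp add: sum.cartesian_product)
  also have "\<dots> = (\<Sum>e\<in>arcs G. \<Sum>k\<le>n. (if k = 0 then of_bool (tail G e = v) * f (e, 0) else 0)
      - (if k = n then of_bool (head G e = v) * f (e, n) else 0))"
    by (intro sum.cong) (auto simp: subdivision_tail_def subdivision_head_def)
  also have "\<dots> = (\<Sum>e\<in>arcs G. of_bool (tail G e = v) * f (e, 0) - of_bool (head G e = v) * f (e, n))"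
    by (intro sum.cong) (simp_all only: sum_subtractf sum.delta finite_atMost atMost_iff le0 order.refl if_True)
  finally show ?thesis .
qed

lemma subdivision_outflow_cell:
  assumes "finite (arcs G)" "e \<in> arcs G" "k < n"
  shows "subdivision_outflow G n f (Inr (e, k)) = f (e, Suc k) - f (e, k)"
proof -
  have t: "subdivision_tail G a = Inr (e, k) \<longleftrightarrow> a = (e, Suc k)" for a
    by (cases a) (auto simp: subdivision_tail_def)
  have h: "subdivision_head G n a = Inr (e, k) \<longleftrightarrow> a = (e, k)" for a
    using assms(3) by (cases a) (auto simp: subdivision_head_def)
  have "subdivision_outflow G n f (Inr (e, k))
      = (\<Sum>a\<in>arcs G \<times> {..n}. (if a = (e, Suc k) then f (e, Suc k) else 0) - (if a = (e, k) then f (e, k) else 0))"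
    unfolding net_outflow_def t h by (intro sum.cong) auto
  then show ?thesis using assms by (simp add: sum_subtractf)
qed

text \<open>Serves for the demands, which are \<open>0\<close> at vertices, and for the outflow of a
  function in \<open>X_K\<close>, which vanishes at vertices by the Kirchhoff conditions.\<close>

lemma sum_subdivision_nodes:
  fixes g :: "'v + 'e \<times> nat \<Rightarrow> real"
  assumes fin: "finite A" "finite S" and S: "S \<subseteq> range Inl \<union> Inr ` (A \<times> {..<n})"
    and zero: "\<And>v. Inl v \<in> S \<Longrightarrow> g (Inl v) = 0"
  shows "sum g S = (\<Sum>e\<in>A. \<Sum>k<n. of_bool (Inr (e, k) \<in> S) * g (Inr (e, k)))"
proof -
  let ?I = "Inr ` (A \<times> {..<n}) :: ('v + 'e \<times> nat) set"
  have "sum g S = sum g (?I \<inter> S)"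
    by (rule sum.mono_neutral_right) (use fin S zero in auto)
  also have "\<dots> = (\<Sum>y\<in>?I. if y \<in> S then g y else 0)"
    using fin by (intro sum.inter_restrict) auto
  also have "\<dots> = (\<Sum>x\<in>A \<times> {..<n}. if Inr x \<in> S then g (Inr x) else 0)"
    by (subst sum.reindex) auto
  also have "\<dots> = (\<Sum>x\<in>A \<times> {..<n}. of_bool (Inr x \<in> S) * g (Inr x))"
    by (rule sum.cong) auto
  also have "\<dots> = (\<Sum>e\<in>A. \<Sum>k<n. of_bool (Inr (e, k) \<in> S) * g (Inr (e, k)))"
    unfolding sum.cartesian_product by (rule sum.cong) auto
  finally show ?thesis .
qed

section \<open>The sup norm and scaling in \<open>X_K\<close>\<close>

lemma X_K_W12: "\<lbrakk>z \<in> X_K G len; e \<in> arcs G\<rbrakk> \<Longrightarrow> W12_edge (len e) (z e)"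
  by (auto simp: X_K_def)

lemma Linf_norm_le:
  assumes "\<And>e. e \<in> arcs G \<Longrightarrow> z e \<in> borel_measurable (edge_measure (len e))"
    and "\<And>e. e \<in> arcs G \<Longrightarrow> AE x in edge_measure (len e). \<bar>z e x\<bar> \<le> C"
  shows "Linf_norm G len z \<le> ennreal C"
  unfolding Linf_norm_def
proof (rule SUP_least, rule esssup_I)
  fix e assume e: "e \<in> arcs G"
  show "(\<lambda>x. ennreal \<bar>z e x\<bar>) \<in> borel_measurable (edge_measure (len e))"
    using assms(1)[OF e] by (intro measurable_compose[OF _ measurable_ennreal] borel_measurable_abs)
  show "AE x in edge_measure (len e). ennreal \<bar>z e x\<bar> \<le> ennreal C"
    using assms(2)[OF e] by eventually_elim (rule ennreal_leI)
qed

lemma Linf_norm_AE: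
  assumes "Linf_norm G len z \<le> ennreal C" "0 \<le> C" "e \<in> arcs G"
  shows "AE x in edge_measure (len e). \<bar>z e x\<bar> \<le> C"
proof -
  have "esssup (edge_measure (len e)) (\<lambda>x. ennreal \<bar>z e x\<bar>) \<le> Linf_norm G len z"
    unfolding Linf_norm_def by (rule SUP_upper[OF assms(3)])
  then have "esssup (edge_measure (len e)) (\<lambda>x. ennreal \<bar>z e x\<bar>) \<le> ennreal C"
    using assms(1) by (rule order_trans)
  then show ?thesis
    using esssup_AE[of "\<lambda>x. ennreal \<bar>z e x\<bar>" "edge_measure (len e)"]
    by (elim eventually_mono) (metis assms(2) ennreal_le_iff order_trans)
qed

lemma chi_eq_indicator: "chi A e = indicator {x. (e, x) \<in> A}"
  by (auto simp: chi_def indicator_def)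

context compact_metric_graph
begin

text \<open>As there are no loops, an incident edge has exactly one end at \<open>v\<close>, and the
  case distinction in \<open>vertex_value\<close> becomes a difference of two indicator
  terms.\<close>

lemma vertex_sum_eq_outflow:
  "(\<Sum>e\<in>incident_edges G v. vertex_value G len z e v)
    = - (\<Sum>e\<in>arcs G. of_bool (tail G e = v) * trace_value (len e) (z e) 0
          - of_bool (head G e = v) * trace_value (len e) (z e) (len e))"
proof -
  have "(\<Sum>e\<in>incident_edges G v. vertex_value G len z e v)
      = (\<Sum>e\<in>incident_edges G v. of_bool (head G e = v) * trace_value (len e) (z e) (len e)
          - of_bool (tail G e = v) * trace_value (len e) (z e) 0)"
    by (rule sum.cong) (auto simp: incident_edges_def vertex_value_def dest: no_loops)
  also have "\<dots> = (\<Sum>e\<in>arcs G. of_bool (head G e = v) * trace_value (len e) (z e) (len e)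
          - of_bool (tail G e = v) * trace_value (len e) (z e) 0)"
    by (rule sum.mono_neutral_left) (auto simp: incident_edges_def)
  finally show ?thesis by (simp add: sum_negf[symmetric])
qed

text \<open>\<open>weak_deriv\<close> is a chosen representative, so scaling is asserted to commute
  with it only almost everywhere.\<close>

lemma X_K_cmult:
  assumes z: "z \<in> X_K G len"
  shows "(\<lambda>e x. c * z e x) \<in> X_K G len"
    and "e \<in> arcs G \<Longrightarrow> AE x in edge_measure (len e).
      graph_deriv len (\<lambda>e x. c * z e x) e x = c * graph_deriv len z e x"
proof -
  have "vertex_value G len (\<lambda>e x. c * z e x) e v = c * vertex_value G len z e v"
    if "e \<in> incident_edges G v" for e v
  proof -
    from that have "e \<in> arcs G" by (auto simp: incident_edges_def)
    then show ?thesis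
      using W12_edge_cmult(3)[OF len_pos X_K_W12[OF z]] len_pos[of e] by (auto simp: vertex_value_def)
  qed
  then have "(\<Sum>e\<in>incident_edges G v. vertex_value G len (\<lambda>e x. c * z e x) e v)
      = c * (\<Sum>e\<in>incident_edges G v. vertex_value G len z e v)" for v
    by (simp add: sum_distrib_left)
  then show "(\<lambda>e x. c * z e x) \<in> X_K G len"
    using z W12_edge_cmult(1)[OF len_pos] by (auto simp: X_K_def)
  show "e \<in> arcs G \<Longrightarrow> AE x in edge_measure (len e).
      graph_deriv len (\<lambda>e x. c * z e x) e x = c * graph_deriv len z e x"
    unfolding graph_deriv_def using W12_edge_cmult(2)[OF len_pos X_K_W12[OF z]] by blast
qed

lemma Linf_norm_cmult_le:
  assumes z: "z \<in> X_K G len" and "Linf_norm G len z \<le> ennreal C" "0 \<le> C"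
  shows "Linf_norm G len (\<lambda>e x. c * z e x) \<le> ennreal (\<bar>c\<bar> * C)"
proof (rule Linf_norm_le)
  fix e assume e: "e \<in> arcs G"
  show "(\<lambda>x. c * z e x) \<in> borel_measurable (edge_measure (len e))"
    using X_K_W12[OF z e] by (auto simp: W12_edge_def L2_edge_def)
  show "AE x in edge_measure (len e). \<bar>c * z e x\<bar> \<le> \<bar>c\<bar> * C"
    using Linf_norm_AE[OF assms(2,3) e] by eventually_elim (simp add: abs_mult mult_left_mono)
qed

lemma integrable_graph_deriv:
  assumes "z \<in> X_K G len" "e \<in> arcs G"
  shows "integrable (edge_measure (len e)) (graph_deriv len z e)"
  unfolding graph_deriv_def
  using W12_edge_weak_deriv(1)[OF X_K_W12[OF assms]] by (rule L2_edge_imp_integrable)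

section \<open>Weak duality: fields bound the Cheeger constant from below\<close>

lemma derivative_bound_le_cheeger:
  assumes z: "z \<in> X_K G len" and norm: "Linf_norm G len z \<le> 1" and h: "0 < h"
    and deriv: "ae_in G len \<Omega> (\<lambda>e x. h \<le> graph_deriv len z e x)"
  shows "ennreal h \<le> cheeger_constant G len \<Omega>"
  unfolding cheeger_constant_def
proof (rule INF_greatest, clarify)
  fix E assume E: "E \<subseteq> \<Omega>" and meas: "graph_measurable G len E" and pos: "0 < graph_length G len E"
  let ?I = "graph_integral G len (\<lambda>e x. chi E e x * graph_deriv len z e x)"
  have "h * graph_length G len E \<le> ?I"
    unfolding graph_length_def graph_integral_def sum_distrib_left
  proof (rule sum_mono)
    fix e assume e: "e \<in> arcs G"
    let ?M = "edge_measure (len e)"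
    interpret M: finite_measure ?M by (rule finite_edge_measure)
    have Ee: "{x. (e, x) \<in> E} \<in> sets lebesgue" using meas e by (auto simp: graph_measurable_def)
    have "h * (LINT x|?M. chi E e x) = (LINT x|?M. chi E e x * h)" by simp
    also have "\<dots> \<le> (LINT x|?M. chi E e x * graph_deriv len z e x)"
    proof (rule integral_mono_AE)
      show "AE x in ?M. chi E e x * h \<le> chi E e x * graph_deriv len z e x"
        using deriv[unfolded ae_in_def, rule_format, OF e]
        by eventually_elim (use E in \<open>auto simp: chi_def indicator_def\<close>)
    qed (simp_all only: chi_eq_indicator integrable_edge_indicator_mult[OF _ Ee]
        integrable_graph_deriv[OF z e] M.integrable_const)
    finally show "h * (LINT x|?M. chi E e x) \<le> (LINT x|?M. chi E e x * graph_deriv len z e x)" .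
  qed
  then have "h \<le> \<bar>?I\<bar> / graph_length G len E"
    using pos by (simp add: field_simps)
  then have "ennreal h \<le> ennreal \<bar>?I\<bar> / ennreal (graph_length G len E)"
    using pos by (simp add: divide_ennreal ennreal_leI)
  also have "\<dots> \<le> perimeter G len E / ennreal (graph_length G len E)"
    unfolding perimeter_def TV_def using z norm
    by (intro divide_right_mono_ennreal SUP_upper) auto
  finally show "ennreal h \<le> perimeter G len E / ennreal (graph_length G len E)" .
qed

section \<open>Strong duality: constructing fields from flows\<close>

text \<open>For the union \<open>E\<close> of the cells in \<open>S\<close>, the demand is
  \<open>h\<close> times the length of \<open>E\<close>, hence at most \<open>Per E\<close>.
  Whichever vertices belong to \<open>S\<close>, the cut bounds \<open>Per E\<close>, because a
  field of norm at most \<open>1\<close> carries at most one unit through each cut arc.\<close>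

lemma cheeger_cut_condition:
  assumes \<Omega>: "graph_measurable G len \<Omega>" and h: "0 < h" "ennreal h \<le> cheeger_constant G len \<Omega>" and n: "0 < n"
    and S: "S \<subseteq> Inl ` verts G \<union> Inr ` {(e, k). e \<in> arcs G \<and> k < n \<and>
        (AE x in edge_measure (len e). x \<in> cell (len e) n k \<longrightarrow> (e, x) \<in> \<Omega>)}"
  shows "(\<Sum>v\<in>S. case v of Inl _ \<Rightarrow> 0 | Inr (e, k) \<Rightarrow> h * len e / real n)
    \<le> real (card {a \<in> arcs G \<times> {..n}. (subdivision_tail G a \<in> S) \<noteq> (subdivision_head G n a \<in> S)})"
    (is "?d \<le> ?cut")
proof -
  let ?P = "\<lambda>e k. Inr (e, k) \<in> S"
  have S': "S \<subseteq> Inl ` verts G \<union> Inr ` (arcs G \<times> {..<n})" using S by auto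
  then have finS: "finite S" by (rule finite_subset) simp
  have S'': "S \<subseteq> range Inl \<union> Inr ` (arcs G \<times> {..<n})" using S' by auto
  \<comment> \<open>Intersecting with \<Omega> makes \<open>E\<close> a competitor in the Cheeger
    constant. By \<open>AE_E\<close> it still equals the union of the cells in \<open>S\<close> up
    to a null set.\<close>
  define E where "E = {(e, x). (e, x) \<in> \<Omega> \<and> ?P e (nat \<lfloor>x * real n / len e\<rfloor>)}"
  have E: "E \<subseteq> \<Omega>" by (auto simp: E_def)
  have Ee: "{x. (e, x) \<in> E} \<in> sets lebesgue" if e: "e \<in> arcs G" for e
  proof -
    have "{x. (e, x) \<in> E} = {x. (e, x) \<in> \<Omega>} \<inter> (\<Union>k\<in>{k. k < n \<and> ?P e k}. cell (len e) n k)"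
    proof (intro set_eqI iffI)
      fix x assume x: "x \<in> {x. (e, x) \<in> E}"
      then have "0 < x" "x < len e" using \<Omega> by (auto simp: E_def graph_measurable_def graph_points_def)
      then show "x \<in> {x. (e, x) \<in> \<Omega>} \<inter> (\<Union>k\<in>{k. k < n \<and> ?P e k}. cell (len e) n k)"
        using x cell_index_less[OF len_pos[OF e] n] mem_cell_iff[OF len_pos[OF e] n, of x]
        by (auto simp: E_def)
    next
      fix x assume x: "x \<in> {x. (e, x) \<in> \<Omega>} \<inter> (\<Union>k\<in>{k. k < n \<and> ?P e k}. cell (len e) n k)"
      then have "0 \<le> x" using \<Omega> by (auto simp: graph_measurable_def graph_points_def)
      then show "x \<in> {x. (e, x) \<in> E}"
        using x mem_cell_iff[OF len_pos[OF e] n, of x] by (auto simp: E_def)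
    qed
    moreover have "{x. (e, x) \<in> \<Omega>} \<in> sets lebesgue" using \<Omega> e by (auto simp: graph_measurable_def)
    ultimately show ?thesis by auto
  qed
  have meas: "graph_measurable G len E"
    using \<Omega> E Ee by (auto simp: graph_measurable_def)
  have AE_E: "AE x in edge_measure (len e). x \<in> {x. (e, x) \<in> E} \<longleftrightarrow> ?P e (nat \<lfloor>x * real n / len e\<rfloor>)"
    if e: "e \<in> arcs G" for e
  proof -
    have "AE x in edge_measure (len e). \<forall>k\<in>{..<n}. ?P e k \<longrightarrow> x \<in> cell (len e) n k \<longrightarrow> (e, x) \<in> \<Omega>"
    proof (rule AE_finite_allI)
      fix k assume "k \<in> {..<n}"
      show "AE x in edge_measure (len e). ?P e k \<longrightarrow> x \<in> cell (len e) n k \<longrightarrow> (e, x) \<in> \<Omega>"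
      proof (cases "?P e k")
        case True
        then have "AE x in edge_measure (len e). x \<in> cell (len e) n k \<longrightarrow> (e, x) \<in> \<Omega>" using S by auto
        then show ?thesis by eventually_elim simp
      qed simp
    qed simp
    moreover have "AE x in edge_measure (len e). x \<in> {0<..<len e}" by (rule AE_I2) simp
    ultimately show ?thesis
    proof eventually_elim
      case (elim x)
      have "nat \<lfloor>x * real n / len e\<rfloor> < n" "x \<in> cell (len e) n (nat \<lfloor>x * real n / len e\<rfloor>)"
        using elim(2) cell_index_less[OF len_pos[OF e] n] iffD2[OF mem_cell_iff[OF len_pos[OF e] n, of x] refl]
        by simp_all
      then show ?case using elim(1) by (auto simp: E_def simp del: atLeastLessThan_iff)
    qed
  qed
  have integral_E: "(LINT x|edge_measure (len e). chi E e x * g x)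
      = (\<Sum>k<n. of_bool (?P e k) * (LINT x|edge_measure (len e). indicator (cell (len e) n k) x * g x))"
    if "e \<in> arcs G" "integrable (edge_measure (len e)) g" for e g
    unfolding chi_eq_indicator
    by (rule integral_union_of_cells[OF len_pos n Ee AE_E]) (use that in auto)
  have length_E: "graph_length G len E = (\<Sum>e\<in>arcs G. \<Sum>k<n. of_bool (?P e k) * (len e / real n))"
    unfolding graph_length_def graph_integral_def
  proof (rule sum.cong)
    fix e assume e: "e \<in> arcs G"
    interpret M: finite_measure "edge_measure (len e)" by (rule finite_edge_measure)
    have "(LINT x|edge_measure (len e). indicator (cell (len e) n k) x) = len e / real n" if "k < n" for k
      using that cell_points_le[OF len_pos[OF e] n, of k] cell_points_le(2)[OF len_pos[OF e] n, of "Suc k"] n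
      by (subst integral_edge_indicator_Ico) (auto simp: field_simps)
    then show "(LINT x|edge_measure (len e). chi E e x) = (\<Sum>k<n. of_bool (?P e k) * (len e / real n))"
      using integral_E[OF e, of "\<lambda>_. 1"] by (simp del: integral_indicator)
  qed simp
  have "?d = (\<Sum>e\<in>arcs G. \<Sum>k<n. of_bool (?P e k) * (h * len e / real n))"
    by (subst sum_subdivision_nodes[OF _ finS S'']) auto
  then have d: "?d = h * graph_length G len E"
    by (simp add: length_E sum_distrib_left mult.assoc mult.left_commute)
  have per: "perimeter G len E \<le> ennreal ?cut"
    unfolding perimeter_def TV_def
  proof (rule SUP_least, clarify)
    fix z assume z: "z \<in> X_K G len" and norm: "Linf_norm G len z \<le> 1"
    \<comment> \<open>The traces at the division points, read as a flow in the subdivided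
      network.\<close>
    define F where "F = (\<lambda>(e, k). trace_value (len e) (z e) (real k * len e / real n))"
    have F: "\<bar>F a\<bar> \<le> 1" if mem: "a \<in> arcs G \<times> {..n}" for a
    proof -
      obtain e k where a: "a = (e, k)" "e \<in> arcs G" "k \<le> n" using mem by auto
      have "AE x in edge_measure (len e). \<bar>z e x\<bar> \<le> 1"
        using Linf_norm_AE[of G len z 1] norm a by simp
      then show ?thesis
        using W12_edge_trace_bound[OF len_pos X_K_W12[OF z]] a cell_points_le[OF len_pos n, of e k]
        by (auto simp: F_def)
    qed
    have out_vertex: "subdivision_outflow G n F (Inl v) = 0" if "Inl v \<in> S" for v
    proof -
      have "v \<in> verts G" using that S' by auto
      then have "(\<Sum>e\<in>incident_edges G v. vertex_value G len z e v) = 0" using z by (auto simp: X_K_def)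
      then show ?thesis
        using n unfolding vertex_sum_eq_outflow subdivision_outflow_vertex by (simp add: F_def)
    qed
    have "graph_integral G len (\<lambda>e x. chi E e x * graph_deriv len z e x)
        = (\<Sum>e\<in>arcs G. \<Sum>k<n. of_bool (?P e k) * subdivision_outflow G n F (Inr (e, k)))"
      unfolding graph_integral_def
    proof (rule sum.cong)
      fix e assume e: "e \<in> arcs G"
      have "(LINT x|edge_measure (len e). indicator (cell (len e) n k) x * graph_deriv len z e x)
          = subdivision_outflow G n F (Inr (e, k))" if k: "k < n" for k
        using W12_edge_trace(3)[OF len_pos[OF e] X_K_W12[OF z e], of "real k * len e / real n" "real (Suc k) * len e / real n"]
          cell_points_le[OF len_pos[OF e] n, of k] cell_points_le(2)[OF len_pos[OF e] n, of "Suc k"] k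
        unfolding subdivision_outflow_cell[OF finite_arcs e k] by (simp add: F_def graph_deriv_def)
      then show "(LINT x|edge_measure (len e). chi E e x * graph_deriv len z e x)
          = (\<Sum>k<n. of_bool (?P e k) * subdivision_outflow G n F (Inr (e, k)))"
        unfolding integral_E[OF e integrable_graph_deriv[OF z e]] by (intro sum.cong) auto
    qed simp
    also have "\<dots> = (\<Sum>v\<in>S. subdivision_outflow G n F v)"
      by (rule sum_subdivision_nodes[symmetric]) (use finS S'' out_vertex in auto)
    \<comment> \<open>Arcs with both ends in \<open>S\<close> or both outside cancel, so only cut
      arcs contribute.\<close>
    also have "\<dots> = (\<Sum>a\<in>arcs G \<times> {..n}. F a * (of_bool (subdivision_tail G a \<in> S) - of_bool (subdivision_head G n a \<in> S)))"
      by (rule sum_net_outflow[OF finS])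
    finally have "\<bar>graph_integral G len (\<lambda>e x. chi E e x * graph_deriv len z e x)\<bar>
        \<le> (\<Sum>a\<in>arcs G \<times> {..n}. \<bar>F a * (of_bool (subdivision_tail G a \<in> S) - of_bool (subdivision_head G n a \<in> S))\<bar>)"
      using sum_abs by simp
    also have "\<dots> \<le> (\<Sum>a\<in>arcs G \<times> {..n}. of_bool ((subdivision_tail G a \<in> S) \<noteq> (subdivision_head G n a \<in> S)))"
    proof (rule sum_mono)
      fix a assume "a \<in> arcs G \<times> {..n}"
      from F[OF this] show "\<bar>F a * (of_bool (subdivision_tail G a \<in> S) - of_bool (subdivision_head G n a \<in> S))\<bar>
          \<le> of_bool ((subdivision_tail G a \<in> S) \<noteq> (subdivision_head G n a \<in> S))"
        by (cases "subdivision_tail G a \<in> S"; cases "subdivision_head G n a \<in> S") auto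
    qed
    also have "\<dots> = ?cut" by (subst sum_of_bool_eq) (auto simp: Int_def)
    finally show "ennreal \<bar>graph_integral G len (\<lambda>e x. chi E e x * graph_deriv len z e x)\<bar> \<le> ennreal ?cut"
      by (rule ennreal_leI)
  qed
  have "0 \<le> graph_length G len E"
    unfolding length_E by (intro sum_nonneg) (auto simp: less_imp_le[OF len_pos])
  then consider "graph_length G len E = 0" | "0 < graph_length G len E" by linarith
  then show ?thesis
  proof cases
    \<comment> \<open>\<open>E\<close> is then no competitor, but the demand vanishes as
      well.\<close>
    case 1
    then show ?thesis unfolding d by simp
  next
    case 2
    have "ennreal h \<le> cheeger_constant G len \<Omega>" by (rule h)
    also have "\<dots> \<le> perimeter G len E / ennreal (graph_length G len E)"
      unfolding cheeger_constant_def using E meas 2 by (intro INF_lower) auto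
    also have "\<dots> \<le> ennreal ?cut / ennreal (graph_length G len E)"
      by (rule divide_right_mono_ennreal[OF per])
    also have "\<dots> = ennreal (?cut / graph_length G len E)"
      using 2 by (simp add: divide_ennreal)
    finally have "h \<le> ?cut / graph_length G len E"
      using 2 by (simp add: ennreal_le_iff)
    then show ?thesis unfolding d using 2 by (simp add: field_simps)
  qed
qed

lemma unit_derivative_below_cheeger:
  assumes \<Omega>: "graph_measurable G len \<Omega>" and h: "0 < h" "ennreal h < cheeger_constant G len \<Omega>"
  obtains z where "z \<in> X_K G len" and "Linf_norm G len z \<le> ennreal (1 / h)"
    and "ae_in G len \<Omega> (\<lambda>e x. graph_deriv len z e x = 1)"
proof -
  \<comment> \<open>The strict inequality leaves room for \<open>h'\<close> above \<open>h\<close>.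
    The flow is built for \<open>h'\<close>, and the gap \<open>1 / h - 1 / h'\<close> absorbs the
    overshoot of the interpolation.\<close>
  obtain c where c: "ennreal h < c" "c < cheeger_constant G len \<Omega>"
    using dense[OF h(2)] by blast
  then obtain h' where h': "h < h'" "ennreal h' \<le> cheeger_constant G len \<Omega>"
    using h(1) by (cases c) (auto simp: ennreal_less_iff less_imp_le)
  have gap: "0 < 1 / h - 1 / h'" using h(1) h'(1) by (simp add: field_simps)
  \<comment> \<open>Chosen so that on every edge the cell length is at most the gap; the total
    length bounds each edge length.\<close>
  define n where "n = Suc (nat \<lceil>(\<Sum>e\<in>arcs G. len e) / (1 / h - 1 / h')\<rceil>)"
  have n: "0 < n" by (simp add: n_def)
  have mesh: "1 / h' + len e / real n \<le> 1 / h" if e: "e \<in> arcs G" for e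
  proof -
    have "len e \<le> (\<Sum>e\<in>arcs G. len e)"
      using e by (intro member_le_sum) (auto simp: less_imp_le[OF len_pos])
    also have "\<dots> \<le> real n * (1 / h - 1 / h')"
    proof -
      have "(\<Sum>e\<in>arcs G. len e) / (1 / h - 1 / h') \<le> real n" unfolding n_def by linarith
      then show ?thesis using gap by (simp add: pos_divide_le_eq)
    qed
    finally have "len e / real n \<le> 1 / h - 1 / h'" using n by (simp add: pos_divide_le_eq mult.commute)
    then show ?thesis by simp
  qed
  \<comment> \<open>Only these cells and the vertices become constrained nodes.\<close>
  define full where "full = {(e, k). e \<in> arcs G \<and> k < n \<and>
      (AE x in edge_measure (len e). x \<in> cell (len e) n k \<longrightarrow> (e, x) \<in> \<Omega>)}"
  \<comment> \<open>The flow stands for \<open>h'\<close> times the field: capacity \<open>1\<close>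
    becomes the bound \<open>1 / h'\<close>, and slope \<open>1\<close> over a full cell becomes a
    demand of \<open>h'\<close> times its length.\<close>
  define d :: "'v + 'e \<times> nat \<Rightarrow> real" where "d = (\<lambda>v. case v of Inl _ \<Rightarrow> 0 | Inr (e, k) \<Rightarrow> h' * len e / real n)"
  have "finite full"
    by (rule finite_subset[of _ "arcs G \<times> {..<n}"]) (auto simp: full_def)
  then have fin: "finite (Inl ` verts G \<union> Inr ` full)" by simp
  have nonneg: "0 \<le> d v" if "v \<in> Inl ` verts G \<union> Inr ` full" for v
    using that h(1) h'(1) len_pos
    by (auto simp: d_def full_def less_imp_le intro!: divide_nonneg_nonneg mult_nonneg_nonneg)
  have cut: "sum d S \<le> real (card {a \<in> arcs G \<times> {..n}. (subdivision_tail G a \<in> S) \<noteq> (subdivision_head G n a \<in> S)})"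
    if "S \<subseteq> Inl ` verts G \<union> Inr ` full" for S
    unfolding d_def
    by (rule cheeger_cut_condition[OF \<Omega> _ h'(2) n]) (use that h(1) h'(1) in \<open>auto simp: full_def\<close>)
  obtain f where f: "\<And>a. \<bar>f a\<bar> \<le> 1"
    and out: "\<And>v. v \<in> Inl ` verts G \<union> Inr ` full \<Longrightarrow> subdivision_outflow G n f v = d v"
    using supply_demand[OF finite_cartesian_product[OF finite_arcs finite_atMost] fin nonneg cut] by metis
  \<comment> \<open>The edges interact only through end values, which the flow has fixed, so the
    field can be chosen edge by edge.\<close>
  define good where "good = (\<lambda>e w. W12_edge (len e) w
      \<and> (AE x in edge_measure (len e). (e, x) \<in> \<Omega> \<longrightarrow> weak_deriv (len e) w x = 1)
      \<and> trace_value (len e) w 0 = f (e, 0) / h' \<and> trace_value (len e) w (len e) = f (e, n) / h'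
      \<and> (\<forall>x\<in>{0<..<len e}. \<bar>w x\<bar> \<le> 1 / h' + len e / real n))"
  have "\<exists>w. good e w" if e: "e \<in> arcs G" for e
  proof -
    have B: "{x. (e, x) \<in> \<Omega>} \<in> sets lebesgue" using \<Omega> e by (auto simp: graph_measurable_def)
    have F: "\<bar>f (e, k) / h'\<bar> \<le> 1 / h'" for k
      using f[of "(e, k)"] h(1) h'(1) by (simp add: divide_right_mono)
    have increment: "f (e, Suc k) / h' - f (e, k) / h' = len e / real n"
      if k: "k < n" and "AE x in edge_measure (len e). x \<in> cell (len e) n k \<longrightarrow> x \<in> {x. (e, x) \<in> \<Omega>}" for k
    proof -
      have "(e, k) \<in> full" using that e by (simp add: full_def)
      then have "f (e, Suc k) - f (e, k) = h' * len e / real n"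
        using out[of "Inr (e, k)"] subdivision_outflow_cell[OF finite_arcs e k, of f] by (simp add: d_def)
      then show ?thesis using h(1) h'(1) by (simp add: diff_divide_distrib[symmetric])
    qed
    show ?thesis
      unfolding good_def by (rule W12_edge_interpolation[OF len_pos[OF e] n B, where F = "\<lambda>k. f (e, k) / h'", OF F increment]) auto
  qed
  then obtain z where "\<forall>e\<in>arcs G. good e (z e)" using bchoice[of "arcs G" good] by blast
  then have z: "\<And>e. e \<in> arcs G \<Longrightarrow> W12_edge (len e) (z e)"
    and deriv: "\<And>e. e \<in> arcs G \<Longrightarrow> AE x in edge_measure (len e). (e, x) \<in> \<Omega> \<longrightarrow> weak_deriv (len e) (z e) x = 1"
    and tr: "\<And>e. e \<in> arcs G \<Longrightarrow> trace_value (len e) (z e) 0 = f (e, 0) / h'"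
      "\<And>e. e \<in> arcs G \<Longrightarrow> trace_value (len e) (z e) (len e) = f (e, n) / h'"
    and bound: "\<And>e x. \<lbrakk>e \<in> arcs G; x \<in> {0<..<len e}\<rbrakk> \<Longrightarrow> \<bar>z e x\<bar> \<le> 1 / h' + len e / real n"
    by (simp_all add: good_def)
  have "z \<in> X_K G len"
  proof -
    have "(\<Sum>e\<in>incident_edges G v. vertex_value G len z e v) = 0" if v: "v \<in> verts G" for v
    proof -
      have "(\<Sum>e\<in>incident_edges G v. vertex_value G len z e v)
          = - (\<Sum>e\<in>arcs G. (of_bool (tail G e = v) * f (e, 0) - of_bool (head G e = v) * f (e, n)) / h')"
        unfolding vertex_sum_eq_outflow using tr by (simp add: diff_divide_distrib)
      also have "\<dots> = - (subdivision_outflow G n f (Inl v) / h')"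
        unfolding subdivision_outflow_vertex by (simp only: sum_divide_distrib)
      also have "\<dots> = 0" using out[of "Inl v"] v by (simp add: d_def)
      finally show ?thesis .
    qed
    then show ?thesis using z by (simp add: X_K_def)
  qed
  moreover have "Linf_norm G len z \<le> ennreal (1 / h)"
  proof (rule Linf_norm_le)
    fix e assume e: "e \<in> arcs G"
    show "z e \<in> borel_measurable (edge_measure (len e))"
      using z[OF e] by (auto simp: W12_edge_def L2_edge_def)
    show "AE x in edge_measure (len e). \<bar>z e x\<bar> \<le> 1 / h"
      using bound[OF e] mesh[OF e] by (intro AE_I2) force
  qed
  moreover have "ae_in G len \<Omega> (\<lambda>e x. graph_deriv len z e x = 1)"
    using deriv by (auto simp: ae_in_def graph_deriv_def)
  ultimately show thesis by (rule that)
qed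

section \<open>Passing between unit norm and unit derivative by scaling\<close>

lemma inverse_norm_le_cheeger:
  assumes z: "z \<in> X_K G len" and deriv: "ae_in G len \<Omega> (\<lambda>e x. graph_deriv len z e x = 1)"
  shows "1 / Linf_norm G len z \<le> cheeger_constant G len \<Omega>"
proof (cases "Linf_norm G len z")
  case (real m)
  \<comment> \<open>Scaling by \<open>c\<close> turns derivative \<open>1\<close> into
    \<open>c\<close> and keeps the norm at most \<open>1\<close>, so weak duality applies.\<close>
  have le: "ennreal c \<le> cheeger_constant G len \<Omega>" if c: "0 < c" "c * m \<le> 1" for c
  proof (rule derivative_bound_le_cheeger[OF X_K_cmult(1)[OF z, of c] _ c(1)])
    have "Linf_norm G len (\<lambda>e x. c * z e x) \<le> ennreal (\<bar>c\<bar> * m)"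
      by (rule Linf_norm_cmult_le[OF z]) (use real in auto)
    also have "\<dots> \<le> ennreal 1" by (rule ennreal_leI) (use c in simp)
    finally show "Linf_norm G len (\<lambda>e x. c * z e x) \<le> 1" by simp
    show "ae_in G len \<Omega> (\<lambda>e x. c \<le> graph_deriv len (\<lambda>e x. c * z e x) e x)"
      unfolding ae_in_def
    proof
      fix e assume e: "e \<in> arcs G"
      show "AE x in edge_measure (len e). (e, x) \<in> \<Omega> \<longrightarrow> c \<le> graph_deriv len (\<lambda>e x. c * z e x) e x"
        using X_K_cmult(2)[OF z e, of c] deriv[unfolded ae_in_def, rule_format, OF e]
        by eventually_elim simp
    qed
  qed
  show ?thesis
  proof (cases "m = 0")
    \<comment> \<open>\<open>1 / 0\<close> is \<open>top\<close> in \<open>ennreal\<close>. With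
      norm \<open>0\<close> every positive \<open>c\<close> is admissible in \<open>le\<close>, so
      the Cheeger constant is infinite too.\<close>
    case True
    have "cheeger_constant G len \<Omega> = top"
    proof (rule ccontr)
      assume "cheeger_constant G len \<Omega> \<noteq> top"
      then obtain r where "0 \<le> r" "cheeger_constant G len \<Omega> = ennreal r"
        by (cases "cheeger_constant G len \<Omega>") auto
      with le[of "r + 1"] True show False by simp
    qed
    then show ?thesis by simp
  next
    case False
    with real have m: "0 < m" by simp
    then have "1 / Linf_norm G len z = ennreal (1 / m)"
      using real divide_ennreal[of 1 m] by simp
    then show ?thesis using le[of "1 / m"] m by simp
  qed
next
  case top
  then show ?thesis by simp
qed

end

theorem theorem3p6:
  fixes G :: "('v, 'e) pre_digraph" and len :: "'e \<Rightarrow> real" and \<Omega> :: "('e \<times> real) set"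
  assumes "compact_metric_graph G len"
    and "graph_measurable G len \<Omega>"
    and "0 < graph_length G len \<Omega>"
    and "graph_length G len \<Omega> < graph_length G len (graph_points G len)"
  shows "cheeger_constant G len \<Omega> =
           Sup {ennreal h | h. 0 < h \<and>
             (\<exists>z\<in>X_K G len. Linf_norm G len z \<le> 1 \<and>
                ae_in G len \<Omega> (\<lambda>e x. h \<le> graph_deriv len z e x))}
       \<and> cheeger_constant G len \<Omega> =
           Sup {1 / Linf_norm G len z | z. z \<in> X_K G len \<and>
             ae_in G len \<Omega> (\<lambda>e x. graph_deriv len z e x = chi \<Omega> e x)}
       \<and> cheeger_constant G len \<Omega> =
           Sup {1 / Linf_norm G len z | z. z \<in> X_K G len \<and>
             ae_in G len \<Omega> (\<lambda>e x. graph_deriv len z e x = 1)}"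
proof -
  interpret compact_metric_graph G len by fact
  let ?c = "cheeger_constant G len \<Omega>"
  let ?A = "{ennreal h | h. 0 < h \<and> (\<exists>z\<in>X_K G len. Linf_norm G len z \<le> 1 \<and>
                ae_in G len \<Omega> (\<lambda>e x. h \<le> graph_deriv len z e x))}"
  let ?B = "{1 / Linf_norm G len z | z. z \<in> X_K G len \<and>
             ae_in G len \<Omega> (\<lambda>e x. graph_deriv len z e x = 1)}"
  have A: "?c = Sup ?A"
  proof (rule antisym)
    show "Sup ?A \<le> ?c"
      by (rule Sup_least) (auto intro: derivative_bound_le_cheeger)
    show "?c \<le> Sup ?A"
    \<comment> \<open>Fields are constructed only strictly below \<open>?c\<close>, so the bound is
      proved for all \<open>y < ?c\<close>. This also covers an infinite \<open>?c\<close>.\<close>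
    proof (rule dense_le)
      fix y assume y: "y < ?c"
      show "y \<le> Sup ?A"
      proof (cases "y = 0")
        case False
        with y obtain h where h: "y = ennreal h" "0 < h" by (cases y) (auto simp: less_le top_unique)
        obtain z where z: "z \<in> X_K G len" "Linf_norm G len z \<le> ennreal (1 / h)"
          "ae_in G len \<Omega> (\<lambda>e x. graph_deriv len z e x = 1)"
          using unit_derivative_below_cheeger[OF assms(2) h(2)] y h(1) by blast
        \<comment> \<open>Multiplying by \<open>h\<close> trades norm \<open>1 / h\<close> and
          derivative \<open>1\<close> for norm \<open>1\<close> and derivative
          \<open>h\<close>.\<close>
        have "Linf_norm G len (\<lambda>e x. h * z e x) \<le> 1"
          using Linf_norm_cmult_le[OF z(1,2), of h] h(2) by simp
        moreover have "ae_in G len \<Omega> (\<lambda>e x. h \<le> graph_deriv len (\<lambda>e x. h * z e x) e x)"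
          unfolding ae_in_def
        proof
          fix e assume e: "e \<in> arcs G"
          show "AE x in edge_measure (len e). (e, x) \<in> \<Omega> \<longrightarrow> h \<le> graph_deriv len (\<lambda>e x. h * z e x) e x"
            using X_K_cmult(2)[OF z(1) e, of h] z(3)[unfolded ae_in_def, rule_format, OF e]
            by eventually_elim simp
        qed
        ultimately have "y \<in> ?A" using X_K_cmult(1)[OF z(1), of h] h by blast
        then show ?thesis by (rule Sup_upper)
      qed simp
    qed
  qed
  have B: "?c = Sup ?B"
  proof (rule antisym)
    show "Sup ?B \<le> ?c"
      by (rule Sup_least) (auto intro: inverse_norm_le_cheeger)
    show "?c \<le> Sup ?B"
    proof (rule dense_le)
      fix y assume y: "y < ?c"
      show "y \<le> Sup ?B"
      proof (cases "y = 0")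
        case False
        with y obtain h where h: "y = ennreal h" "0 < h" by (cases y) (auto simp: less_le top_unique)
        obtain z where z: "z \<in> X_K G len" "Linf_norm G len z \<le> ennreal (1 / h)"
          "ae_in G len \<Omega> (\<lambda>e x. graph_deriv len z e x = 1)"
          using unit_derivative_below_cheeger[OF assms(2) h(2)] y h(1) by blast
        obtain m where m: "Linf_norm G len z = ennreal m" "0 \<le> m"
          using z(2) by (cases "Linf_norm G len z") (auto simp: top_unique)
        \<comment> \<open>If the norm is \<open>0\<close>, the right side is
          \<open>top\<close>.\<close>
        have "y \<le> 1 / Linf_norm G len z"
        proof (cases "m = 0")
          case False
          then have "m > 0" "h \<le> 1 / m" using m z(2) h(2) by (auto simp: ennreal_le_iff field_simps)
          then show ?thesis using m(1) h(1) divide_ennreal[of 1 m] by (simp add: ennreal_leI)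
        qed (simp add: m)
        also have "\<dots> \<le> Sup ?B" using z by (intro Sup_upper) blast
        finally show ?thesis .
      qed simp
    qed
  qed
  \<comment> \<open>Both conditions are imposed on \<Omega>, where \<open>chi \<Omega>\<close> is
    \<open>1\<close>, so the second supremum is the third.\<close>
  have "ae_in G len \<Omega> (\<lambda>e x. graph_deriv len z e x = chi \<Omega> e x)
      \<longleftrightarrow> ae_in G len \<Omega> (\<lambda>e x. graph_deriv len z e x = 1)" for z
    unfolding ae_in_def by (intro ball_cong AE_cong refl) (auto simp: chi_def)
  with A B show ?thesis by simp
qed

end
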